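(* Let $n\geq 1$ and let $F:\mathcal{M}_{n}\rightarrow \mathcal{M}_{n}$ be a Lipschitz mapping with $F(0)=0$ such that $$\sigma(F(x)-F(y))\cap\sigma(x-y)\neq\varnothing\qquad (x,y\in\mathcal{M}_n).$$ Then there exists an invertible $u\in\mathcal{M}_n$ such that either $F(x)=uxu^{-1}$ for all $x\in\mathcal{M}_n$, or $F(x)=ux^{t}u^{-1}$ for all $x\in\mathcal{M}_n$.
   Context: $\mathcal{M}_n$ denotes the space of all complex $n\times n$ matrices, equipped with the operator norm (Lipschitz is with respect to this norm). For $x\in\mathcal{M}_n$, $\sigma(x)$ denotes the spectrum (set of eigenvalues) of $x$, and $x^t$ denotes its transpose. *)

theory Defs
  imports "HOL-Analysis.Analysis"
begin

definition mat_opnorm :: "complex^'n^'n \<Rightarrow> real" where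
  "mat_opnorm A = onorm (\<lambda>v::complex^'n. A *v v)"

definition opnorm_lipschitz :: "(complex^'n^'n \<Rightarrow> complex^'n^'n) \<Rightarrow> bool" where
  "opnorm_lipschitz F \<longleftrightarrow> (\<exists>L. \<forall>x y. mat_opnorm (F x - F y) \<le> L * mat_opnorm (x - y))"

definition mat_spectrum :: "complex^'n^'n \<Rightarrow> complex set" where
  "mat_spectrum A = {c. \<exists>v. v \<noteq> 0 \<and> A *v v = c *s v}"

end

(* At almost every point F has a Frechet derivative T by Rademacher's theorem, and T is a real linear
   map such that T h and h always share an eigenvalue. Write T h = A h + B (cnj h) with A and B complex
   linear. For h = s diag(d) s^-1 the condition says that the product over i of the polynomials
   det (A h + B k - d_i) vanishes on the real form k = cnj h, hence for independent h and k; so one factor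
   vanishes identically, and by the symmetry in the entries of d all of them do. Thus A h + B k and h have
   the same spectrum for generic h and k, the traces of their squares and cubes agree, and this forces
   B = 0. So the derivative of F is complex linear almost everywhere; averages of F over small balls are
   entire on complex lines and of linear growth, hence affine by Liouville, and F itself is complex linear.
   Preserving the traces of squares and cubes makes F a Jordan automorphism of the matrix algebra, and these
   are read off from the images of the matrix units. *)

theory Submission
  imports Defs "HOL-Complex_Analysis.Complex_Analysis"
begin

text \<open>A shared eigenvalue is a closed condition with finitely many candidates, so it survives
  the limit of difference quotients and passes to the derivative. To separate h from its conjugate
  the condition must be polynomial, and \<open>matrix_inv\<close> is not, so conjugation by s is
  done with the adjugate and the determinant is absorbed into the eigenvalues. Once k varies freely
  against h, the cross term, the trace of A h times B k, must vanish, and A is onto because it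
  preserves a nondegenerate form. The exceptional set of Rademacher's theorem can contain a whole
  complex line as soon as n > 1, so restricting F to a line gives nothing; this is why F is averaged
  over balls of full dimension. Affinity on every complex line is not yet additivity; the Lipschitz
  bound on F (a + t h) - F (t h) for large t closes that gap. The analysis of real linear maps is
  used twice: on the derivatives of F, for complex linearity, and on F itself, for the
  traces.\<close>

no_notation fps_nth (infixl "$" 75)

section \<open>Rademacher's theorem\<close>

text \<open>A Vitali argument with a change of variable: the \<open>\<phi>\<close>-images of short
  intervals of small slope, taken inside \<open>W\<close>, cover the \<open>\<phi>\<close>-image of
  \<open>A\<close> finely. A disjoint selection misses only a null set, and the corresponding
  \<open>\<psi>\<close>-images have at most \<open>p\<close> times the length. With both functions
  general, the lemma can also be read backwards, the identity standing in either place.\<close>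

lemma vitali_slope_cover:
  fixes \<phi> \<psi> :: "real \<Rightarrow> real"
  assumes mono: "strict_mono \<phi>" "mono \<psi>"
    and lip: "\<And>x y. \<bar>\<psi> x - \<psi> y\<bar> \<le> C * \<bar>\<phi> x - \<phi> y\<bar>"
    and cont: "continuous_on UNIV \<phi>"
    and p: "0 < p"
    and slope: "\<And>x d. x \<in> A \<Longrightarrow> 0 < d \<Longrightarrow> \<exists>u v. u < v \<and> u \<le> x \<and> x \<le> v \<and> v - u < d \<and> \<psi> v - \<psi> u \<le> p * (\<phi> v - \<phi> u)"
    and W: "open W" "W \<in> lmeasurable" "\<phi> ` A \<subseteq> W"
  obtains B where "B \<in> lmeasurable" "\<psi> ` A \<subseteq> B" "measure lebesgue B \<le> p * measure lebesgue W"
proof -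
  have iso: "continuous (at x) \<phi>" for x
    using cont by (simp add: continuous_on_eq_continuous_at)
  define K where "K = {(u, v). u < v \<and> \<psi> v - \<psi> u \<le> p * (\<phi> v - \<phi> u) \<and> {\<phi> u..\<phi> v} \<subseteq> W}"
  define c where "c = (\<lambda>(u, v). (\<phi> u + \<phi> v) / 2)"
  define r where "r = (\<lambda>(u, v). (\<phi> v - \<phi> u) / 2)"
  have cb: "cball (c i) (r i) = {\<phi> (fst i)..\<phi> (snd i)}" for i
    by (cases i) (auto simp: c_def r_def cball_eq_atLeastAtMost field_simps)
  have r0: "0 < r i" if "i \<in> K" for i
    using that mono(1) by (auto simp: K_def r_def strict_mono_def)
  have S: "\<exists>i. i \<in> K \<and> y \<in> cball (c i) (r i) \<and> r i < d" if y: "y \<in> \<phi> ` A" and "0 < d" for y d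
  proof -
    obtain x where x: "x \<in> A" "y = \<phi> x" using y by auto
    have "y \<in> W" using W x by auto
    then obtain e where e: "e > 0" "ball y e \<subseteq> W"
      using W(1) open_contains_ball by blast
    let ?e = "min e d"
    have "0 < ?e" using e \<open>0 < d\<close> by auto
    then obtain \<delta> where \<delta>: "\<delta> > 0" "\<And>z. \<bar>z - x\<bar> < \<delta> \<Longrightarrow> \<bar>\<phi> z - \<phi> x\<bar> < ?e"
      using iso[of x] unfolding continuous_at_eps_delta dist_real_def by blast
    obtain u v where uv: "u < v" "u \<le> x" "x \<le> v" "v - u < \<delta>" "\<psi> v - \<psi> u \<le> p * (\<phi> v - \<phi> u)"
      using slope[OF x(1) \<delta>(1)] by blast
    have 1: "\<bar>\<phi> u - \<phi> x\<bar> < ?e" "\<bar>\<phi> v - \<phi> x\<bar> < ?e"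
      using \<delta>(2)[of u] \<delta>(2)[of v] uv by auto
    have 2: "\<phi> u \<le> \<phi> x" "\<phi> x \<le> \<phi> v"
      using uv mono(1) by (auto simp: strict_mono_less_eq)
    have "{\<phi> u..\<phi> v} \<subseteq> ball y e"
      using 1 x by (auto simp: dist_real_def)
    then have "(u, v) \<in> K" using uv e by (auto simp: K_def)
    moreover have "y \<in> cball (c (u,v)) (r (u,v))" unfolding cb using 2 x by auto
    moreover have "r (u,v) < d" using 1 by (auto simp: r_def)
    ultimately show ?thesis by blast
  qed
  obtain D where D: "countable D" "D \<subseteq> K"
     "pairwise (\<lambda>i j. disjnt (cball (c i) (r i)) (cball (c j) (r j))) D"
     "negligible (\<phi> ` A - (\<Union>i \<in> D. cball (c i) (r i)))"
    using Vitali_covering_theorem_cballs[of K r "\<phi> ` A" c, OF r0 S] by blast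
  define N where "N = \<phi> ` A - (\<Union>i \<in> D. cball (c i) (r i))"
  \<comment> \<open>\<open>\<theta>\<close> carries \<open>\<phi> x\<close> to
    \<open>\<psi> x\<close> and is \<open>C\<close>-Lipschitz on the range of \<open>\<phi>\<close>
    by \<open>lip\<close>, so the null set missed by the selection is sent to a null set.\<close>
  define \<theta> where "\<theta> = \<psi> \<circ> inv \<phi>"
  have inj: "inj \<phi>" using mono(1) by (simp add: strict_mono_imp_inj_on)
  have negN: "negligible (\<theta> ` N)"
  proof (rule negligible_locally_Lipschitz_image)
    show "negligible N" using D by (simp add: N_def)
    fix y assume y: "y \<in> N"
    show "\<exists>T B. open T \<and> y \<in> T \<and> (\<forall>z\<in>N \<inter> T. norm (\<theta> z - \<theta> y) \<le> B * norm (z - y))"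
    proof (intro exI[of _ UNIV] exI[of _ C] conjI ballI)
      fix z assume "z \<in> N \<inter> UNIV"
      then obtain a b where "y = \<phi> a" "z = \<phi> b" using y by (auto simp: N_def)
      then show "norm (\<theta> z - \<theta> y) \<le> C * norm (z - y)"
        using lip[of b a] inj by (simp add: \<theta>_def)
    qed auto
  qed simp
  define I where "I = (\<lambda>i. {\<psi> (fst i)..\<psi> (snd i)})"
  define B where "B = \<theta> ` N \<union> (\<Union>i\<in>D. I i)"
  have sub: "\<psi> ` A \<subseteq> B"
  proof
    fix y assume "y \<in> \<psi> ` A"
    then obtain x where x: "x \<in> A" "y = \<psi> x" by auto
    show "y \<in> B"
    proof (cases "\<phi> x \<in> N")
      case True
      then have "\<theta> (\<phi> x) \<in> \<theta> ` N" by blast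
      then show ?thesis using inj x by (simp add: B_def \<theta>_def)
    next
      case False
      then obtain i where i: "i \<in> D" "\<phi> x \<in> cball (c i) (r i)" using x by (auto simp: N_def)
      then have "fst i \<le> x" "x \<le> snd i" using mono(1) unfolding cb by (auto simp: strict_mono_less_eq)
      then have "y \<in> I i" using mono(2) x by (auto simp: I_def mono_def)
      then show ?thesis using i by (auto simp: B_def)
    qed
  qed
  have Im: "I i \<in> lmeasurable" for i by (simp add: I_def)
  have mI: "measure lebesgue (I i) \<le> p * measure lebesgue (cball (c i) (r i))" if "i \<in> D" for i
  proof -
    have "fst i < snd i" "\<psi> (snd i) - \<psi> (fst i) \<le> p * (\<phi> (snd i) - \<phi> (fst i))"
      using that D by (auto simp: K_def)
    moreover have "\<phi> (fst i) \<le> \<phi> (snd i)" "\<psi> (fst i) \<le> \<psi> (snd i)" 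
      using \<open>fst i < snd i\<close> mono by (auto simp: strict_mono_less_eq mono_def)
    ultimately show ?thesis unfolding cb I_def by simp
  qed
  \<comment> \<open>The estimate is made for finite subfamilies, where disjointness inside
    \<open>W\<close> can be summed; the countable union inherits the bound.\<close>
  have fin: "measure lebesgue (\<Union>i\<in>F. I i) \<le> p * measure lebesgue W" if F: "finite F" "F \<subseteq> D" for F
  proof -
    have "measure lebesgue (\<Union>i\<in>F. I i) \<le> (\<Sum>i\<in>F. measure lebesgue (I i))"
      using F Im by (intro measure_UNION_le) auto
    also have "\<dots> \<le> (\<Sum>i\<in>F. p * measure lebesgue (cball (c i) (r i)))"
      using F mI by (intro sum_mono) auto
    also have "\<dots> = p * (\<Sum>i\<in>F. measure lebesgue (cball (c i) (r i)))"
      by (simp add: sum_distrib_left)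
    also have "(\<Sum>i\<in>F. measure lebesgue (cball (c i) (r i))) = measure lebesgue (\<Union>i\<in>F. cball (c i) (r i))"
    proof (rule measure_finite_Union[symmetric])
      show "finite F" by fact
      show "disjoint_family_on (\<lambda>i. cball (c i) (r i)) F"
        using D(3) F(2) unfolding disjoint_family_on_def pairwise_def disjnt_def by blast
      show "(\<lambda>i. cball (c i) (r i)) ` F \<subseteq> sets lebesgue" by auto
      show "emeasure lebesgue (cball (c i) (r i)) \<noteq> \<infinity>" for i
        using lmeasurable_cball[of "c i" "r i"] by (metis fmeasurableD2 infinity_ennreal_def)
    qed
    also have "\<dots> \<le> measure lebesgue W"
    proof (rule measure_mono_fmeasurable)
      show "(\<Union>i\<in>F. cball (c i) (r i)) \<subseteq> W"
        using F D(2) unfolding cb K_def by fastforce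
      show "(\<Union>i\<in>F. cball (c i) (r i)) \<in> sets lebesgue" using F by auto
    qed fact
    finally show ?thesis using p by simp
  qed
  have "(\<Union>i\<in>D. I i) \<in> lmeasurable \<and> measure lebesgue (\<Union>i\<in>D. I i) \<le> p * measure lebesgue W"
    using fmeasurable_UN_bound[OF D(1), of I lebesgue "p * measure lebesgue W"]
      measure_UN_bound[OF D(1), of I lebesgue "p * measure lebesgue W"] Im fin by blast
  moreover have "measure lebesgue B \<le> measure lebesgue (\<theta> ` N) + measure lebesgue (\<Union>i\<in>D. I i)"
    unfolding B_def using negN calculation by (intro measure_Un_le) (auto simp: negligible_imp_measurable fmeasurableD)
  ultimately show ?thesis
    using that[of B] sub negN fmeasurable.Un[of "\<theta> ` N" lebesgue "\<Union> (I ` D)"]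
    by (auto simp: B_def negligible_imp_measure0 negligible_imp_measurable)
qed

text \<open>The points at which the lower derivative of \<open>f\<close> in direction \<open>v\<close> is below \<open>p\<close>; applied
  to \<open>- f\<close> and \<open>- q\<close> it speaks about upper derivatives above \<open>q\<close>.\<close>

definition low_slope :: "('a::real_normed_vector \<Rightarrow> real) \<Rightarrow> 'a \<Rightarrow> real \<Rightarrow> 'a set" where
  "low_slope f v p = {x. \<forall>k::nat. \<exists>s. 0 < \<bar>s\<bar> \<and> \<bar>s\<bar> < 1 / Suc k \<and> (f (x + s *\<^sub>R v) - f x) / s < p}"

text \<open>For fixed \<open>k\<close> the union over the uncountably many \<open>s\<close> is still
  open, because \<open>f\<close> is continuous; so the set is a countable intersection of open
  sets.\<close>

lemma low_slope_borel:
  fixes f :: "'a::euclidean_space \<Rightarrow> real"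
  assumes "continuous_on UNIV f"
  shows "low_slope f v p \<in> sets borel"
proof -
  have "low_slope f v p = (\<Inter>k::nat. \<Union>s\<in>{s. 0 < \<bar>s\<bar> \<and> \<bar>s\<bar> < 1 / Suc k}. {x. (f (x + s *\<^sub>R v) - f x) / s < p})"
    by (auto simp: low_slope_def)
  moreover have "open {x. (f (x + s *\<^sub>R v) - f x) / s < p}" for s
    unfolding divide_inverse
    by (intro open_Collect_less continuous_intros continuous_on_compose2[OF assms]) auto
  ultimately show ?thesis
    by (simp only:) (intro sets.countable_INT'' borel_open open_UN, auto)
qed

lemma lmeasurable_outer_open:
  assumes "S \<in> lmeasurable" "0 < (e::real)"
  obtains T where "open T" "S \<subseteq> T" "T \<in> lmeasurable" "measure lebesgue T < measure lebesgue S + e"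
proof -
  obtain T where T: "open T" "S \<subseteq> T" "T - S \<in> lmeasurable" "emeasure lebesgue (T - S) < ennreal e"
    using sets_lebesgue_outer_open[of S e] assms by blast
  have eq: "T = S \<union> (T - S)" using T by auto
  have "T \<in> lmeasurable" using fmeasurable.Un[OF assms(1) T(3)] eq by simp
  moreover have "measure lebesgue (T - S) < e"
    using T assms by (simp add: emeasure_eq_measure2 ennreal_less_iff)
  moreover have "measure lebesgue T \<le> measure lebesgue S + measure lebesgue (T - S)"
    using measure_Un_le[of S lebesgue "T - S"] assms T eq by (simp add: fmeasurableD)
  ultimately show ?thesis using that T by fastforce
qed

text \<open>On a set of measure \<open>m\<close> where quotients at arbitrarily small steps fall
  below \<open>p\<close> and also exceed \<open>q\<close>, a tilted increasing function has an image
  of measure at most \<open>a * m\<close>, while its inverse shrinks that image at least by the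
  factor \<open>b\<close>. Since \<open>a < b\<close>, only \<open>m = 0\<close> is
  possible.\<close>

lemma low_slope_real_negligible:
  fixes f :: "real \<Rightarrow> real"
  assumes lip: "\<And>x y. \<bar>f x - f y\<bar> \<le> K * \<bar>x - y\<bar>" and "p < q"
  shows "negligible (low_slope f 1 p \<inter> low_slope (\<lambda>x. - f x) 1 (- q))"
proof -
  \<comment> \<open>Adding slope \<open>K + 1\<close> makes every slope of \<open>g\<close> at least
    1, so \<open>g\<close> is strictly increasing with a 1-Lipschitz inverse; \<open>a\<close> and
    \<open>b\<close> below are \<open>p\<close> and \<open>q\<close> after this shift.\<close>
  define g where "g = (\<lambda>x. f x + (K + 1) * x)"
  have K: "0 \<le> K" using lip[of 0 1] by simp
  have cont: "continuous_on UNIV f"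
    using lip K by (intro lipschitz_on_continuous_on[of K]) (auto simp: lipschitz_on_def dist_real_def)
  have cg: "continuous_on UNIV g" unfolding g_def by (intro continuous_intros cont)
  have g1: "y - x \<le> g y - g x" if "x \<le> y" for x y
    using lip[of x y] that by (simp add: g_def algebra_simps abs_if split: if_splits)
  have g2: "\<bar>g x - g y\<bar> \<le> (2 * K + 1) * \<bar>x - y\<bar>" for x y
  proof -
    have "\<bar>g x - g y\<bar> = \<bar>(f x - f y) + (K + 1) * (x - y)\<bar>" by (simp add: g_def algebra_simps)
    also have "\<dots> \<le> \<bar>f x - f y\<bar> + (K + 1) * \<bar>x - y\<bar>" using K abs_triangle_ineq[of "f x - f y" "(K + 1) * (x - y)"] by (simp add: abs_mult)
    also have "\<dots> \<le> K * \<bar>x - y\<bar> + (K + 1) * \<bar>x - y\<bar>" using lip by simp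
    finally show ?thesis by (simp add: algebra_simps)
  qed
  have sm: "strict_mono g" using g1 by (smt (verit) strict_mono_def)
  define a where "a = p + K + 1"
  define b where "b = q + K + 1"
  have "a < b" using assms by (simp add: a_def b_def)
  have lo: "\<exists>u v. u < v \<and> u \<le> x \<and> x \<le> v \<and> v - u < d \<and> g v - g u \<le> a * (v - u)"
    if x: "x \<in> low_slope f 1 p" and d: "0 < d" for x d
  proof -
    obtain k :: nat where k: "1 / Suc k < d" using d nat_approx_posE by metis
    obtain s where s: "0 < \<bar>s\<bar>" "\<bar>s\<bar> < 1 / Suc k" "(f (x + s) - f x) / s < p"
      using x unfolding low_slope_def by auto
    have sd: "\<bar>s\<bar> < d" using s(2) k by (rule less_trans)
    show ?thesis
    proof (cases "s > 0")
      case True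
      then show ?thesis using s(1,3) sd
        by (intro exI[of _ x] exI[of _ "x + s"]) (auto simp: g_def a_def field_simps)
    next
      case False
      then show ?thesis using s(1,3) sd
        by (intro exI[of _ "x + s"] exI[of _ x]) (auto simp: g_def a_def field_simps)
    qed
  qed
  have hi: "\<exists>u v. u < v \<and> u \<le> x \<and> x \<le> v \<and> v - u < d \<and> b * (v - u) \<le> g v - g u"
    if x: "x \<in> low_slope (\<lambda>x. - f x) 1 (- q)" and d: "0 < d" for x d
  proof -
    obtain k :: nat where k: "1 / Suc k < d" using d nat_approx_posE by metis
    obtain s where s: "0 < \<bar>s\<bar>" "\<bar>s\<bar> < 1 / Suc k" "(- f (x + s) + f x) / s < - q"
      using x unfolding low_slope_def by auto
    have sd: "\<bar>s\<bar> < d" using s(2) k by (rule less_trans)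
    show ?thesis
    proof (cases "s > 0")
      case True
      then show ?thesis using s(1,3) sd
        by (intro exI[of _ x] exI[of _ "x + s"]) (auto simp: g_def b_def field_simps)
    next
      case False
      then show ?thesis using s(1,3) sd
        by (intro exI[of _ "x + s"] exI[of _ x]) (auto simp: g_def b_def field_simps)
    qed
  qed
  define E where "E n = low_slope f 1 p \<inter> low_slope (\<lambda>x. - f x) 1 (- q) \<inter> {- real n..real n}" for n
  have "negligible (E n)" for n
  proof (cases "E n = {}")
    \<comment> \<open>A point of \<open>E n\<close> yields \<open>1 \<le> a\<close>: all slopes of
      \<open>g\<close> are at least 1, yet one of them is at most \<open>a\<close>.\<close>
    case False
    then obtain x where "x \<in> low_slope f 1 p" by (auto simp: E_def)
    from lo[OF this zero_less_one] obtain u v where "u < v" "g v - g u \<le> a * (v - u)" by auto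
    have "v - u \<le> a * (v - u)"
      using g1[OF less_imp_le[OF \<open>u < v\<close>]] \<open>g v - g u \<le> a * (v - u)\<close> by (rule order_trans)
    then have a: "1 \<le> a"
      using \<open>u < v\<close> by (intro mult_right_le_imp_le[of 1 "v - u" a]) (simp_all only: mult_1 diff_gt_0_iff_gt)
    have cn: "continuous_on UNIV (\<lambda>x. - f x)" by (intro continuous_intros cont)
    have Em: "E n \<in> lmeasurable"
    proof (rule fmeasurableI2[of "{- real n..real n}"])
      show "E n \<in> sets lebesgue" unfolding E_def using low_slope_borel[OF cont, of 1 p] low_slope_borel[OF cn, of 1 "- q"]
        by (auto intro!: sets.Int)
    qed (auto simp: E_def)
    define m where "m = measure lebesgue (E n)"
    have m0: "0 \<le> m" by (simp add: m_def)
    have ineq: "b * m \<le> a * (m + e) + e" if e: "0 < e" for e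
    proof -
      obtain W where W: "open W" "E n \<subseteq> W" "W \<in> lmeasurable" "measure lebesgue W < m + e"
        using lmeasurable_outer_open[OF Em e] unfolding m_def by blast
      obtain B where B: "B \<in> lmeasurable" "g ` E n \<subseteq> B" "measure lebesgue B \<le> a * measure lebesgue W"
      proof (rule vitali_slope_cover[of "\<lambda>x. x" g "2 * K + 1" a "E n" W])
        show "\<exists>u v. u < v \<and> u \<le> x \<and> x \<le> v \<and> v - u < d \<and> g v - g u \<le> a * (v - u)" if "x \<in> E n" "0 < d" for x d
          using lo that by (simp add: E_def)
      qed (use W sm g2 a in \<open>auto simp: strict_mono_def strict_mono_mono\<close>)
      obtain V where V: "open V" "B \<subseteq> V" "V \<in> lmeasurable" "measure lebesgue V < measure lebesgue B + e"
        using lmeasurable_outer_open[OF B(1) e] by blast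
      \<comment> \<open>The covering lemma with the roles exchanged: slopes of \<open>g\<close> that
        are at least \<open>b\<close> are slopes of its inverse that are at most
        \<open>1 / b\<close>.\<close>
      obtain D where D: "D \<in> lmeasurable" "(\<lambda>x. x) ` E n \<subseteq> D" "measure lebesgue D \<le> (1 / b) * measure lebesgue V"
      proof (rule vitali_slope_cover[of g "\<lambda>x. x" 1 "1 / b" "E n" V])
        show "\<exists>u v. u < v \<and> u \<le> x \<and> x \<le> v \<and> v - u < d \<and> v - u \<le> 1 / b * (g v - g u)" if "x \<in> E n" "0 < d" for x d
        proof -
          obtain u v where "u < v" "u \<le> x" "x \<le> v" "v - u < d" "b * (v - u) \<le> g v - g u"
            using hi[of x d] \<open>x \<in> E n\<close> \<open>0 < d\<close> by (auto simp: E_def)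
          then show ?thesis using a \<open>a < b\<close> by (intro exI[of _ u] exI[of _ v]) (auto simp: field_simps)
        qed
        show "\<bar>x - y\<bar> \<le> 1 * \<bar>g x - g y\<bar>" for x y
          using g1[of x y] g1[of y x] by (cases "x \<le> y") auto
        show "mono (\<lambda>x::real. x)" by (simp add: mono_def)
        show "g ` E n \<subseteq> V" using B V by auto
      qed (use V cg sm a \<open>a < b\<close> in auto)
      have "m \<le> measure lebesgue D"
        unfolding m_def using D Em by (intro measure_mono_fmeasurable) auto
      then have "b * m \<le> b * measure lebesgue D" using a \<open>a < b\<close> by simp
      also have "\<dots> \<le> measure lebesgue V" using D a \<open>a < b\<close> by (simp add: field_simps)
      also have "measure lebesgue V \<le> a * measure lebesgue W + e" using V B by simp
      also have "\<dots> \<le> a * (m + e) + e" using W a by simp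
      finally show ?thesis .
    qed
    have "m = 0"
    proof (rule ccontr)
      assume "m \<noteq> 0"
      then have m: "0 < m" using m0 by simp
      \<comment> \<open>With this choice \<open>(a + 1) * e\<close> is half of
        \<open>(b - a) * m\<close>, which \<open>ineq\<close> forbids.\<close>
      define e where "e = (b - a) * m / (2 * (a + 1))"
      have "0 < e" using m a \<open>a < b\<close> by (simp add: e_def)
      from ineq[OF this] have "(b - a) * m \<le> (a + 1) * e" by (simp add: algebra_simps)
      also have "\<dots> = (b - a) * m / 2" using a by (simp add: e_def divide_simps)
      finally show False using m \<open>a < b\<close> by simp
    qed
    then show ?thesis using Em by (simp add: m_def negligible_iff_measure)
  qed simp
  moreover have "low_slope f 1 p \<inter> low_slope (\<lambda>x. - f x) 1 (- q) = (\<Union>n. E n)"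
  proof -
    have "\<exists>n. x \<in> {- real n..real n}" for x :: real
    proof -
      obtain n where "\<bar>x\<bar> \<le> real n" using real_arch_simple by blast
      then show ?thesis by (intro exI[of _ n]) auto
    qed
    then show ?thesis unfolding E_def by blast
  qed
  ultimately show ?thesis using negligible_Union_nat[of E] by simp
qed

lemma low_slopeI:
  assumes "\<exists>\<^sub>F s in at (0::real). (f (x + s *\<^sub>R v) - f x) / s < p"
  shows "x \<in> low_slope f v p"
  unfolding low_slope_def
proof (intro CollectI allI)
  fix k :: nat
  have "\<forall>\<^sub>F s::real in at 0. s \<noteq> 0 \<and> \<bar>s\<bar> < 1 / Suc k"
    unfolding eventually_at by (intro exI[of _ "1 / Suc k"]) (auto simp: dist_real_def)
  from frequently_eventually_conj[OF assms this]
  show "\<exists>s. 0 < \<bar>s\<bar> \<and> \<bar>s\<bar> < 1 / Suc k \<and> (f (x + s *\<^sub>R v) - f x) / s < p"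
    by (auto dest!: frequently_ex)
qed

text \<open>A gap between lower and upper derivative contains two rationals, so countably many
  exceptional sets suffice. The limit is the infimum of the rationals \<open>p\<close> with
  \<open>x \<in> low_slope f v p\<close>; the Lipschitz bound makes that infimum finite.\<close>

lemma slope_convergent:
  fixes f :: "'a::real_normed_vector \<Rightarrow> real"
  assumes lip: "\<And>x y. \<bar>f x - f y\<bar> \<le> K * norm (x - y)"
    and x: "x \<notin> (\<Union>(p, q)\<in>{(p, q). p \<in> \<rat> \<and> q \<in> \<rat> \<and> p < q}. low_slope f v p \<inter> low_slope (\<lambda>x. - f x) v (- q))"
  obtains l where "((\<lambda>s. (f (x + s *\<^sub>R v) - f x) / s) \<longlongrightarrow> l) (at 0)"
proof -
  define \<phi> where "\<phi> s = (f (x + s *\<^sub>R v) - f x) / s" for s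
  define C where "C = K * norm v"
  have b: "\<bar>\<phi> s\<bar> \<le> C" if "s \<noteq> 0" for s
    using lip[of "x + s *\<^sub>R v" x] that by (simp add: \<phi>_def C_def field_simps)
  have lo: "\<forall>\<^sub>F s in at 0. p \<le> \<phi> s" if "x \<notin> low_slope f v p" for p
    using that low_slopeI[of f x v p] by (auto simp: \<phi>_def frequently_def not_less)
  have hi: "\<forall>\<^sub>F s in at 0. \<phi> s \<le> q" if "x \<notin> low_slope (\<lambda>x. - f x) v (- q)" for q
  proof (rule ccontr)
    assume "\<not> ?thesis"
    then have "\<exists>\<^sub>F s in at 0. q < \<phi> s" by (simp add: frequently_def not_less)
    then have "\<exists>\<^sub>F s in at 0. (- f (x + s *\<^sub>R v) - - f x) / s < - q"
      by (rule frequently_elim1) (auto simp: \<phi>_def minus_divide_left[symmetric] diff_divide_distrib)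
    then show False using low_slopeI[of "\<lambda>x. - f x" x v "- q"] that by blast
  qed
  define S where "S = {p \<in> \<rat>. x \<in> low_slope f v p}"
  have SC: "- C \<le> p" if pS: "p \<in> S" for p
  proof -
    obtain s where "0 < \<bar>s\<bar>" "\<phi> s < p" using pS unfolding S_def low_slope_def \<phi>_def by blast
    then show ?thesis using b[of s] by auto
  qed
  obtain r where r: "C < r" "r \<in> \<rat>" using Rats_dense_in_real[of C "C + 1"] by auto
  have "x \<in> low_slope f v r"
  proof (rule low_slopeI)
    have "\<forall>\<^sub>F s in at 0. \<phi> s < r"
      unfolding eventually_at using b r by (intro exI[of _ 1]) (force simp: abs_le_iff)
    then show "\<exists>\<^sub>F s in at 0. (f (x + s *\<^sub>R v) - f x) / s < r"
      unfolding \<phi>_def by (rule eventually_frequently[rotated]) simp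
  qed
  then have S0: "S \<noteq> {}" using r by (auto simp: S_def)
  have bd: "bdd_below S" using SC by (auto simp: bdd_below_def)
  define l where "l = Inf S"
  have "(\<phi> \<longlongrightarrow> l) (at 0)"
  proof (rule order_tendstoI)
    fix a assume "a < l"
    then obtain p where p: "p \<in> \<rat>" "a < p" "p < l" using Rats_dense_in_real by blast
    then have "p \<notin> S" using cInf_lower[OF _ bd] by (force simp: l_def)
    then have "\<forall>\<^sub>F s in at 0. p \<le> \<phi> s" using p lo by (auto simp: S_def)
    then show "\<forall>\<^sub>F s in at 0. a < \<phi> s" using p by (auto elim: eventually_mono)
  next
    fix a assume "l < a"
    then obtain p where p: "p \<in> S" "p < a" using cInf_lessD[OF S0] by (auto simp: l_def)
    then obtain q where q: "q \<in> \<rat>" "p < q" "q < a" using Rats_dense_in_real by blast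
    then have "x \<notin> low_slope (\<lambda>x. - f x) v (- q)" using x p by (auto simp: S_def)
    then have "\<forall>\<^sub>F s in at 0. \<phi> s \<le> q" by (rule hi)
    then show "\<forall>\<^sub>F s in at 0. \<phi> s < a" using q by (auto elim: eventually_mono)
  qed
  then show ?thesis using that unfolding \<phi>_def by blast
qed

text \<open>Fubini for the pairs \<open>(s, x)\<close> with
  \<open>x + s *\<^sub>R v \<in> N\<close>. Sliced at \<open>s\<close> this is a translate of
  \<open>N\<close>, sliced at \<open>x\<close> it is null; so the measure of \<open>N\<close>,
  integrated as a constant over the whole real line, is zero.\<close>

lemma null_sets_if_slices_null:
  fixes N :: "'a::euclidean_space set"
  assumes N: "N \<in> sets borel" and sl: "\<And>x. {s::real. x + s *\<^sub>R v \<in> N} \<in> null_sets lborel"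
  shows "N \<in> null_sets lborel"
proof -
  define M where "M = {(s::real, x::'a). x + s *\<^sub>R v \<in> N}"
  have "M = (\<lambda>(s, x). x + s *\<^sub>R v) -` N \<inter> space (lborel \<Otimes>\<^sub>M lborel)"
    by (auto simp: M_def space_pair_measure)
  moreover have meas: "(\<lambda>(s, x). x + s *\<^sub>R v) \<in> (lborel :: real measure) \<Otimes>\<^sub>M (lborel :: 'a measure) \<rightarrow>\<^sub>M borel"
    by measurable
  ultimately have Mm: "M \<in> sets (lborel \<Otimes>\<^sub>M lborel)" using measurable_sets[OF meas N] by simp
  have tr: "emeasure lborel (Pair s -` M) = emeasure lborel N" for s
  proof -
    have "emeasure lborel N = emeasure (distr lborel borel ((+) (s *\<^sub>R v))) N"
      by (simp add: lborel_distr_plus)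
    also have "\<dots> = emeasure lborel ((+) (s *\<^sub>R v) -` N \<inter> space lborel)"
      using N by (intro emeasure_distr) auto
    also have "(+) (s *\<^sub>R v) -` N \<inter> space lborel = Pair s -` M"
      by (auto simp: M_def add.commute)
    finally show ?thesis by simp
  qed
  have "(\<integral>\<^sup>+s. emeasure lborel N \<partial>(lborel::real measure)) = emeasure (lborel \<Otimes>\<^sub>M lborel) M"
    using lborel.emeasure_pair_measure_alt[OF Mm] tr by simp
  also have "\<dots> = (\<integral>\<^sup>+x. emeasure lborel ((\<lambda>s. (s, x)) -` M) \<partial>lborel)"
    by (rule lborel_pair.emeasure_pair_measure_alt2[OF Mm])
  also have "\<dots> = (\<integral>\<^sup>+x. 0 \<partial>(lborel :: 'a measure))"
  proof (rule nn_integral_cong)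
    fix x :: 'a
    have "(\<lambda>s. (s, x)) -` M = {s. x + s *\<^sub>R v \<in> N}" by (auto simp: M_def)
    then show "emeasure lborel ((\<lambda>s. (s, x)) -` M) = 0" using sl[of x] by auto
  qed
  finally have "emeasure lborel N = 0" by simp
  then show ?thesis using N by (simp add: null_sets_def)
qed

section \<open>Directional derivatives of Lipschitz functions\<close>

definition ddiff :: "('a::real_normed_vector \<Rightarrow> real) \<Rightarrow> 'a \<Rightarrow> 'a \<Rightarrow> real" where
  "ddiff f v x = lim (\<lambda>n. real (Suc n) * (f (x + (1 / real (Suc n)) *\<^sub>R v) - f x))"

lemma continuous_on_if_abs_lipschitz:
  fixes f :: "'a::real_normed_vector \<Rightarrow> real"
  assumes lip: "\<And>x y. \<bar>f x - f y\<bar> \<le> K * norm (x - y)"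
  shows "continuous_on S f"
proof -
  have "\<bar>f x - f y\<bar> \<le> \<bar>K\<bar> * norm (x - y)" for x y
    using lip[of x y] by (smt (verit) mult_right_mono norm_ge_zero)
  then show ?thesis
    by (intro lipschitz_on_continuous_on[of "\<bar>K\<bar>"]) (auto simp: lipschitz_on_def dist_real_def dist_norm)
qed

text \<open>\<open>ddiff\<close> is a limit along the sequence \<open>1 / real (Suc n)\<close> and
  \<open>lim\<close> is total, so measurability is available before anything is known about the
  existence of the derivative.\<close>

lemma borel_measurable_ddiff:
  fixes f :: "'a::euclidean_space \<Rightarrow> real"
  assumes "continuous_on UNIV f"
  shows "ddiff f v \<in> borel_measurable borel"
proof -
  have [measurable]: "f \<in> borel_measurable borel" using assms by (rule borel_measurable_continuous_onI)
  show ?thesis unfolding ddiff_def by measurable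
qed

lemma slope_sequence:
  assumes "((\<lambda>s. (f (x + s *\<^sub>R v) - f x) / s) \<longlongrightarrow> (l::real)) (at 0)"
  shows "(\<lambda>n. real (Suc n) * (f (x + (1 / real (Suc n)) *\<^sub>R v) - f x)) \<longlonglongrightarrow> l"
proof -
  have "filterlim (\<lambda>n. 1 / real (Suc n)) (at 0) sequentially"
    unfolding filterlim_at using LIMSEQ_inverse_real_of_nat by (auto simp: inverse_eq_divide)
  from filterlim_compose[OF assms this] show ?thesis by (simp add: mult.commute)
qed

lemma ddiff_eqI:
  assumes "((\<lambda>s. (f (x + s *\<^sub>R v) - f x) / s) \<longlongrightarrow> l) (at 0)"
  shows "ddiff f v x = l"
  unfolding ddiff_def using slope_sequence[OF assms] by (rule limI)

lemma AE_directional_derivative: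
  fixes f :: "'a::euclidean_space \<Rightarrow> real"
  assumes lip: "\<And>x y. \<bar>f x - f y\<bar> \<le> K * norm (x - y)"
  shows "AE x in lborel. ((\<lambda>s. (f (x + s *\<^sub>R v) - f x) / s) \<longlongrightarrow> ddiff f v x) (at 0)"
proof -
  have cont: "continuous_on UNIV f" using lip by (rule continuous_on_if_abs_lipschitz)
  have cn: "continuous_on UNIV (\<lambda>x. - f x)" by (intro continuous_intros cont)
  define P :: "(real \<times> real) set" where "P = {(p, q). p \<in> \<rat> \<and> q \<in> \<rat> \<and> p < q}"
  define E where "E = (\<lambda>(p, q). low_slope f v p \<inter> low_slope (\<lambda>x. - f x) v (- q))"
  have "P \<subseteq> \<rat> \<times> \<rat>" by (auto simp: P_def)
  then have cP: "countable P" by (rule countable_subset) (simp add: countable_rat)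
  have null: "E i \<in> null_sets lborel" if "i \<in> P" for i
  proof -
    obtain p q where i: "i = (p, q)" "p < q" using \<open>i \<in> P\<close> by (auto simp: P_def)
    show ?thesis
    proof (rule null_sets_if_slices_null)
      show "E i \<in> sets borel"
        unfolding i E_def by (auto intro!: sets.Int low_slope_borel cont cn)
      fix x
      define g where "g s = f (x + s *\<^sub>R v)" for s
      \<comment> \<open>The slope condition at a point looks at \<open>f\<close> only along the line
        in direction \<open>v\<close>, which reduces each slice to one variable.\<close>
      have eq: "{s. x + s *\<^sub>R v \<in> E i} = low_slope g 1 p \<inter> low_slope (\<lambda>x. - g x) 1 (- q)"
        by (auto simp: i E_def low_slope_def g_def algebra_simps)
      have gl: "\<bar>g s - g t\<bar> \<le> (K * norm v) * \<bar>s - t\<bar>" for s t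
        using lip[of "x + s *\<^sub>R v" "x + t *\<^sub>R v"]
        by (simp add: g_def scaleR_diff_left[symmetric] mult_ac)
      have cg: "continuous_on UNIV g" "continuous_on UNIV (\<lambda>x. - g x)"
        unfolding g_def by (intro continuous_intros continuous_on_compose2[OF cont]; auto)+
      have "negligible {s. x + s *\<^sub>R v \<in> E i}"
        unfolding eq by (rule low_slope_real_negligible[OF gl i(2)])
      moreover have "{s. x + s *\<^sub>R v \<in> E i} \<in> sets borel"
        unfolding eq by (intro sets.Int low_slope_borel cg)
      ultimately show "{s. x + s *\<^sub>R v \<in> E i} \<in> null_sets lborel"
        by (simp add: negligible_iff_null_sets null_sets_completion_iff)
    qed
  qed
  have "(\<Union>i\<in>P. E i) \<in> null_sets lborel" using cP null by (rule null_sets_UN')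
  then show ?thesis
  proof (rule AE_I', intro subsetI)
    fix x assume "x \<in> {x \<in> space lborel. \<not> ((\<lambda>s. (f (x + s *\<^sub>R v) - f x) / s) \<longlongrightarrow> ddiff f v x) (at 0)}"
    then have x: "\<not> ((\<lambda>s. (f (x + s *\<^sub>R v) - f x) / s) \<longlongrightarrow> ddiff f v x) (at 0)" by simp
    show "x \<in> (\<Union>i\<in>P. E i)"
    proof (rule ccontr)
      assume "x \<notin> (\<Union>i\<in>P. E i)"
      then obtain l where l: "((\<lambda>s. (f (x + s *\<^sub>R v) - f x) / s) \<longlongrightarrow> l) (at 0)"
        using slope_convergent[OF lip, of x v] unfolding P_def E_def by blast
      show False using x l ddiff_eqI[OF l] by simp
    qed
  qed
qed

text \<open>Lebesgue measure is determined by its values on boxes. The weight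
  \<open>1 + g x / (M + 1)\<close> is nonnegative and gives every box its volume, so it is a density
  of Lebesgue measure with respect to itself and equals 1 almost everywhere.\<close>

lemma AE_zero_if_box_integrals_zero:
  fixes g :: "'a::euclidean_space \<Rightarrow> real"
  assumes [measurable]: "g \<in> borel_measurable borel" and bd: "\<And>x. \<bar>g x\<bar> \<le> M"
    and box: "\<And>l u. (\<integral>x. indicator (box l u) x * g x \<partial>lborel) = 0"
  shows "AE x in lborel. g x = 0"
proof -
  have M: "0 \<le> M" using bd[of 0] by simp
  define h where "h x = 1 + g x / (M + 1)" for x
  have h0: "0 \<le> h x" for x
    using bd[of x] M by (simp add: h_def field_simps abs_le_iff)
  have [measurable]: "h \<in> borel_measurable borel" unfolding h_def by measurable
  have "lborel = density lborel (\<lambda>x. ennreal (h x))"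
  proof (rule lborel_eqI)
    fix l u :: 'a assume lu: "\<And>b. b \<in> Basis \<Longrightarrow> l \<bullet> b \<le> u \<bullet> b"
    have fin: "emeasure lborel (box l u) < \<infinity>" by (simp add: emeasure_lborel_box_eq)
    have i1: "integrable lborel (indicator (box l u) :: 'a \<Rightarrow> real)"
      using fin by (intro integrable_real_indicator) auto
    have i2: "integrable lborel (\<lambda>x. indicator (box l u) x * g x)"
    proof (rule Bochner_Integration.integrable_bound)
      show "integrable lborel (\<lambda>x. M * indicator (box l u) x)" using i1 by simp
      show "AE x in lborel. norm (indicator (box l u) x * g x) \<le> norm (M * indicator (box l u) x)"
        using bd M by (auto simp: indicator_def)
    qed measurable
    have eq: "h x * indicator (box l u) x = indicator (box l u) x + (1 / (M + 1)) * (indicator (box l u) x * g x)" for x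
      by (simp add: h_def algebra_simps)
    have i3: "integrable lborel (\<lambda>x. h x * indicator (box l u) x)"
      unfolding eq using i1 i2 by (intro Bochner_Integration.integrable_add integrable_mult_right) auto
    have "emeasure (density lborel (\<lambda>x. ennreal (h x))) (box l u) = (\<integral>\<^sup>+x. ennreal (h x) * indicator (box l u) x \<partial>lborel)"
      by (intro emeasure_density) auto
    also have "\<dots> = (\<integral>\<^sup>+x. ennreal (h x * indicator (box l u) x) \<partial>lborel)"
      by (intro nn_integral_cong) (auto simp: indicator_def)
    also have "\<dots> = ennreal (\<integral>x. h x * indicator (box l u) x \<partial>lborel)"
      using i3 h0 by (intro nn_integral_eq_integral) auto
    also have "(\<integral>x. h x * indicator (box l u) x \<partial>lborel) = (\<integral>x. indicator (box l u) x \<partial>lborel) + (1 / (M + 1)) * (\<integral>x. indicator (box l u) x * g x \<partial>lborel)"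
      unfolding eq using i1 i2 by (subst Bochner_Integration.integral_add) auto
    also have "\<dots> = measure lborel (box l u)" by (simp add: box)
    also have "ennreal \<dots> = emeasure lborel (box l u)" using fin by (simp add: emeasure_eq_ennreal_measure)
    also have "\<dots> = ennreal (\<Prod>b\<in>Basis. (u - l) \<bullet> b)" using lu by (simp add: emeasure_lborel_box_eq inner_diff_left)
    finally show "emeasure (density lborel (\<lambda>x. ennreal (h x))) (box l u) = ennreal (\<Prod>b\<in>Basis. (u - l) \<bullet> b)" .
  qed simp
  then have "density lborel (\<lambda>x. ennreal (h x)) = density lborel (\<lambda>x. 1)" by (simp add: density_1)
  then have "AE x in lborel. ennreal (h x) = 1"
    by (intro sigma_finite_measure.density_unique[OF sigma_finite_lborel]) auto
  then show ?thesis
  proof (rule eventually_mono)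
    fix x assume "ennreal (h x) = 1"
    then have "h x = 1" using h0[of x] by (metis ennreal_1 ennreal_inj zero_le_one)
    then show "g x = 0" using M by (simp add: h_def)
  qed
qed

section \<open>Additivity of the directional derivative in the direction\<close>

lemma lborel_integral_translate:
  fixes g :: "'a::euclidean_space \<Rightarrow> 'b::{banach, second_countable_topology}"
  assumes "g \<in> borel_measurable borel"
  shows "(\<integral>x. g (a + x) \<partial>lborel) = (\<integral>x. g x \<partial>lborel)"
proof -
  have "(\<integral>x. g x \<partial>lborel) = (\<integral>x. g x \<partial>distr lborel borel ((+) a))" by (simp add: lborel_distr_plus)
  also have "\<dots> = (\<integral>x. g (a + x) \<partial>lborel)" using assms by (intro integral_distr) auto
  finally show ?thesis by simp
qed

lemma frontier_box_null: "frontier (box l u) \<in> null_sets lborel"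
proof -
  have "frontier (box l u) \<in> sets borel" by (intro borel_closed frontier_closed)
  moreover have "negligible (frontier (box l u))" by (rule negligible_convex_frontier) simp
  ultimately show ?thesis by (simp add: negligible_iff_null_sets null_sets_completion_iff)
qed

lemma tendsto_indicator_off_frontier:
  assumes "y \<notin> frontier B" "z \<longlonglongrightarrow> y"
  shows "(\<lambda>n::nat. indicator B (z n) :: real) \<longlonglongrightarrow> indicator B y"
proof (cases "y \<in> B")
  case True
  then have "y \<in> interior B" using assms closure_subset by (auto simp: frontier_def)
  then have "\<forall>\<^sub>F n in sequentially. z n \<in> interior B" using assms(2) by (auto dest: topological_tendstoD[OF _ open_interior])
  then have "\<forall>\<^sub>F n in sequentially. indicator B (z n) = (indicator B y :: real)"
    by eventually_elim (use True interior_subset in \<open>auto simp: indicator_def\<close>)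
  then show ?thesis by (rule tendsto_eventually)
next
  case False
  then have "y \<in> - closure B" using assms interior_subset by (auto simp: frontier_def)
  then have "\<forall>\<^sub>F n in sequentially. z n \<in> - closure B"
    using assms(2) topological_tendstoD[of z y sequentially "- closure B"] by auto
  then have "\<forall>\<^sub>F n in sequentially. indicator B (z n) = (indicator B y :: real)"
    by eventually_elim (use False closure_subset in \<open>auto simp: indicator_def\<close>)
  then show ?thesis by (rule tendsto_eventually)
qed

context
  fixes f :: "'a::euclidean_space \<Rightarrow> real" and K :: real
  assumes lip: "\<And>x y. \<bar>f x - f y\<bar> \<le> K * norm (x - y)"
begin

abbreviation (input) "dq n v x \<equiv> real (Suc n) * (f (x + (1 / real (Suc n)) *\<^sub>R v) - f x)"

lemma f_measurable [measurable]: "f \<in> borel_measurable borel"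
  using continuous_on_if_abs_lipschitz[OF lip] by (rule borel_measurable_continuous_onI)

lemma ddiff_measurable [measurable]: "ddiff f v \<in> borel_measurable borel"
  using continuous_on_if_abs_lipschitz[OF lip] by (rule borel_measurable_ddiff)

lemma dq_bound: "\<bar>dq n v x\<bar> \<le> K * norm v"
proof -
  have "\<bar>dq n v x\<bar> = real (Suc n) * \<bar>f (x + (1 / real (Suc n)) *\<^sub>R v) - f x\<bar>"
    by (simp only: abs_mult abs_of_nat)
  also have "\<dots> \<le> real (Suc n) * (K * norm ((1 / real (Suc n)) *\<^sub>R v))"
    using lip[of "x + (1 / real (Suc n)) *\<^sub>R v" x] by (intro mult_left_mono) auto
  also have "\<dots> = K * norm v" by (simp del: of_nat_Suc)
  finally show ?thesis .
qed

text \<open>Dominated convergence with a drifting box; the drift absorbs the shifted base point that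
  arises when a quotient is split over two directions. The indicators converge off the frontier, and
  since no shift is longer than \<open>norm w\<close>, a constant on a ball enlarged by
  \<open>norm w\<close> dominates.\<close>

lemma box_integral_limit:
  "(\<lambda>n. \<integral>y. indicator (box l u) (y - (1 / real (Suc n)) *\<^sub>R w) * dq n v y \<partial>lborel)
     \<longlonglongrightarrow> (\<integral>y. indicator (box l u) y * ddiff f v y \<partial>lborel)"
  and box_integrable: "integrable lborel (\<lambda>y. indicator (box l u) (y - (1 / real (Suc n)) *\<^sub>R w) * dq n v y)"
  and box_integrable_ddiff: "integrable lborel (\<lambda>y. indicator (box l u) y * ddiff f v y)"
proof -
  obtain R where R: "\<And>x. x \<in> box l u \<Longrightarrow> norm x \<le> R"
    using bounded_box[of l u] unfolding bounded_iff by blast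
  define W where "W y = K * norm v * indicator (cball 0 (R + norm w)) y" for y :: 'a
  have "emeasure lborel (cball (0::'a) (R + norm w)) < \<infinity>"
    using emeasure_lborel_cball_finite[of "0::'a" "R + norm w"] by (simp add: less_top[symmetric])
  then have iW: "integrable lborel W" unfolding W_def
    by (intro integrable_mult_right integrable_real_indicator) auto
  have bdd: "norm (indicator (box l u) (y - (1 / real (Suc n)) *\<^sub>R w) * dq n v y) \<le> W y" for n y
  proof (cases "y - (1 / real (Suc n)) *\<^sub>R w \<in> box l u")
    case True
    have "norm y \<le> norm (y - (1 / real (Suc n)) *\<^sub>R w) + norm ((1 / real (Suc n)) *\<^sub>R w)"
      using norm_triangle_ineq[of "y - (1 / real (Suc n)) *\<^sub>R w" "(1 / real (Suc n)) *\<^sub>R w"] by simp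
    moreover have "norm ((1 / real (Suc n)) *\<^sub>R w) \<le> norm w"
      by (simp add: divide_le_eq mult_le_cancel_left1)
    ultimately have "norm y \<le> R + norm w" using R[OF True] by linarith
    then show ?thesis using dq_bound[of n y v] True by (simp add: W_def)
  next
    case False
    have "0 \<le> K * norm v" using dq_bound[of 0 0 v] by linarith
    then show ?thesis using False by (simp add: W_def indicator_def)
  qed
  have AEl: "AE y in lborel. (\<lambda>n. indicator (box l u) (y - (1 / real (Suc n)) *\<^sub>R w) * dq n v y) \<longlonglongrightarrow> indicator (box l u) y * ddiff f v y"
    using AE_directional_derivative[OF lip, of v] AE_not_in[OF frontier_box_null[of l u]]
  proof eventually_elim
    case (elim y)
    have "(\<lambda>n. y - (1 / real (Suc n)) *\<^sub>R w) \<longlonglongrightarrow> y - 0 *\<^sub>R w"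
      using LIMSEQ_inverse_real_of_nat by (intro tendsto_intros) (simp add: inverse_eq_divide)
    then have "(\<lambda>n. y - (1 / real (Suc n)) *\<^sub>R w) \<longlonglongrightarrow> y" by simp
    from tendsto_indicator_off_frontier[OF elim(2) this] slope_sequence[OF elim(1)]
    show ?case by (rule tendsto_mult)
  qed
  have m1: "(\<lambda>y. indicator (box l u) y * ddiff f v y) \<in> borel_measurable lborel" by measurable
  have m2: "(\<lambda>y. indicator (box l u) (y - (1 / real (Suc n)) *\<^sub>R w) * dq n v y) \<in> borel_measurable lborel" for n
    by measurable
  note dc = m1 m2 iW AEl AE_I2[OF bdd]
  show "(\<lambda>n. \<integral>y. indicator (box l u) (y - (1 / real (Suc n)) *\<^sub>R w) * dq n v y \<partial>lborel)
     \<longlonglongrightarrow> (\<integral>y. indicator (box l u) y * ddiff f v y \<partial>lborel)"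
    by (rule integral_dominated_convergence[OF dc])
  show "integrable lborel (\<lambda>y. indicator (box l u) (y - (1 / real (Suc n)) *\<^sub>R w) * dq n v y)"
    by (rule integrable_dominated_convergence2[OF dc])
  show "integrable lborel (\<lambda>y. indicator (box l u) y * ddiff f v y)"
    by (rule integrable_dominated_convergence[OF dc])
qed

text \<open>The quotient for \<open>v + w\<close> is that for \<open>v\<close> plus that for
  \<open>w\<close> at a point moved along \<open>v\<close>. The limit of the moved quotient is not
  controlled pointwise, but under the integral a translation transfers the shift to the box.\<close>

lemma box_integral_ddiff_add:
  "(\<integral>y. indicator (box l u) y * ddiff f (v + w) y \<partial>lborel) =
    (\<integral>y. indicator (box l u) y * ddiff f v y \<partial>lborel) + (\<integral>y. indicator (box l u) y * ddiff f w y \<partial>lborel)"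
proof -
  define B where "B = box l u"
  have eq: "(\<integral>y. indicator B y * dq n (v + w) y \<partial>lborel) =
      (\<integral>y. indicator B y * dq n v y \<partial>lborel) + (\<integral>y. indicator B (y - (1 / real (Suc n)) *\<^sub>R v) * dq n w y \<partial>lborel)" for n
  proof -
    let ?a = "(1 / real (Suc n)) *\<^sub>R v"
    have m: "(\<lambda>y. indicator B (y - ?a) * dq n w y) \<in> borel_measurable borel" unfolding B_def by measurable
    have e: "indicator B y * dq n (v + w) y = indicator B y * dq n v y + indicator B ((?a + y) - ?a) * dq n w (?a + y)" for y
      by (simp add: algebra_simps)
    have i: "integrable lborel (\<lambda>y. indicator B (y - ?a) * dq n w y)"
      unfolding B_def by (rule box_integrable)
    have "integrable (distr lborel borel ((+) ?a)) (\<lambda>y. indicator B (y - ?a) * dq n w y)"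
      using i by (simp add: lborel_distr_plus)
    then have i': "integrable lborel (\<lambda>y. indicator B ((?a + y) - ?a) * dq n w (?a + y))"
      using integrable_distr_eq[of "(+) ?a" lborel borel "\<lambda>y. indicator B (y - ?a) * dq n w y"] m by simp
    have i0: "integrable lborel (\<lambda>y. indicator B y * dq n v y)"
      using box_integrable[of l u n 0 v] by (simp add: B_def)
    show ?thesis unfolding e
      by (subst Bochner_Integration.integral_add[OF i0 i'], subst lborel_integral_translate[OF m]) simp
  qed
  have "(\<lambda>n. \<integral>y. indicator B y * dq n (v + w) y \<partial>lborel) \<longlonglongrightarrow> (\<integral>y. indicator B y * ddiff f (v + w) y \<partial>lborel)"
    using box_integral_limit[of l u 0 "v + w"] by (simp add: B_def)
  moreover have "(\<lambda>n. \<integral>y. indicator B y * dq n (v + w) y \<partial>lborel) \<longlonglongrightarrow> 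
     (\<integral>y. indicator B y * ddiff f v y \<partial>lborel) + (\<integral>y. indicator B y * ddiff f w y \<partial>lborel)"
    unfolding eq using box_integral_limit[of l u 0 v] box_integral_limit[of l u v w]
    by (intro tendsto_add) (simp_all add: B_def)
  ultimately show ?thesis unfolding B_def by (rule LIMSEQ_unique)
qed

lemma AE_abs_ddiff_le: "AE x in lborel. \<bar>ddiff f v x\<bar> \<le> K * norm v"
  using AE_directional_derivative[OF lip, of v]
proof eventually_elim
  case (elim x)
  have "(\<lambda>n. \<bar>dq n v x\<bar>) \<longlonglongrightarrow> \<bar>ddiff f v x\<bar>" by (intro tendsto_rabs slope_sequence elim)
  then show ?case by (rule LIMSEQ_le_const2) (use dq_bound in blast)
qed

lemma AE_ddiff_add: "AE x in lborel. ddiff f (v + w) x = ddiff f v x + ddiff f w x"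
proof -
  define C where "C = K * norm (v + w) + K * norm v + K * norm w"
  define g where "g x = ddiff f (v + w) x - (ddiff f v x + ddiff f w x)" for x
  \<comment> \<open>The derivatives obey their bounds only almost everywhere, whereas the box
    criterion asks for a bound everywhere; so the defect of additivity is clipped at its almost sure
    bound \<open>C\<close>.\<close>
  define g' where "g' x = max (- C) (min C (g x))" for x
  have [measurable]: "g \<in> borel_measurable borel" unfolding g_def by measurable
  have [measurable]: "g' \<in> borel_measurable borel" unfolding g'_def by measurable
  have "0 \<le> K * norm v" for v :: 'a using dq_bound[of 0 0 v] by linarith
  then have C: "0 \<le> C" by (simp add: C_def add_nonneg_nonneg)
  have gg: "AE x in lborel. g' x = g x"
    using AE_abs_ddiff_le[of v] AE_abs_ddiff_le[of w] AE_abs_ddiff_le[of "v + w"]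
    by eventually_elim (simp add: g'_def g_def C_def abs_le_iff min_def max_def)
  have "AE x in lborel. g' x = 0"
  proof (rule AE_zero_if_box_integrals_zero[of _ C])
    show "\<bar>g' x\<bar> \<le> C" for x using C by (auto simp: g'_def)
    fix l u :: 'a
    have "(\<integral>x. indicator (box l u) x * g' x \<partial>lborel) = (\<integral>x. indicator (box l u) x * g x \<partial>lborel)"
      using gg by (intro integral_cong_AE) auto
    also have "\<dots> = (\<integral>x. indicator (box l u) x * ddiff f (v + w) x - (indicator (box l u) x * ddiff f v x + indicator (box l u) x * ddiff f w x) \<partial>lborel)"
      by (simp add: g_def algebra_simps)
    also have "\<dots> = 0"
      using box_integrable_ddiff[of l u] box_integral_ddiff_add[of l u v w] by simp
    finally show "(\<integral>x. indicator (box l u) x * g' x \<partial>lborel) = 0" .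
  qed measurable
  with gg show ?thesis by eventually_elim (simp add: g_def)
qed

lemma AE_ddiff_scale: "AE x in lborel. ddiff f (c *\<^sub>R v) x = c * ddiff f v x"
  using AE_directional_derivative[OF lip, of v]
proof eventually_elim
  case (elim x)
  show ?case
  proof (cases "c = 0")
    case True
    then show ?thesis using ddiff_eqI[of f x "0 *\<^sub>R v" 0] by simp
  next
    case False
    show ?thesis
    proof (rule ddiff_eqI)
      have "filterlim (\<lambda>s. s * c) (at 0) (at 0)"
        unfolding filterlim_at using False
        by (auto simp: eventually_at_filter intro!: tendsto_eq_intros)
      from tendsto_mult[OF tendsto_const[of c] filterlim_compose[OF elim this]]
      show "((\<lambda>s. (f (x + s *\<^sub>R c *\<^sub>R v) - f x) / s) \<longlongrightarrow> c * ddiff f v x) (at 0)"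
        using False by simp
    qed
  qed
qed

lemma AE_ddiff_sum:
  assumes "finite S"
  shows "AE x in lborel. ddiff f (\<Sum>b\<in>S. c b *\<^sub>R b) x = (\<Sum>b\<in>S. c b * ddiff f b x)"
  using assms
proof (induction S rule: finite_induct)
  case empty
  show ?case using AE_ddiff_scale[of 0 0] by simp
next
  case (insert b S)
  show ?case
    using insert.IH AE_ddiff_scale[of "c b" b] AE_ddiff_add[of "c b *\<^sub>R b" "\<Sum>b\<in>S. c b *\<^sub>R b"]
    by eventually_elim (simp add: insert)
qed

text \<open>Almost everywhere the derivatives in countably many dense directions exist and depend
  linearly on the direction. Compactness of the unit sphere leaves finitely many of them up to
  \<open>\<epsilon>\<close>, and the Lipschitz bound makes the convergence uniform in the
  direction.\<close>

lemma AE_differentiable_real: "AE x in lborel. \<exists>L. (f has_derivative L) (at x)"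
proof -
  obtain D :: "'a set" where D: "countable D" "\<And>X. open X \<Longrightarrow> X \<noteq> {} \<Longrightarrow> \<exists>d \<in> D. d \<in> X"
    using countable_dense_setE by blast
  have "AE x in lborel. \<forall>v\<in>D. ((\<lambda>s. (f (x + s *\<^sub>R v) - f x) / s) \<longlongrightarrow> (\<Sum>b\<in>Basis. (v \<bullet> b) * ddiff f b x)) (at 0)"
  proof (intro AE_ball_countable' D(1))
    fix v
    show "AE x in lborel. ((\<lambda>s. (f (x + s *\<^sub>R v) - f x) / s) \<longlongrightarrow> (\<Sum>b\<in>Basis. (v \<bullet> b) * ddiff f b x)) (at 0)"
      using AE_ddiff_sum[OF finite_Basis, of "\<lambda>b. v \<bullet> b"] AE_directional_derivative[OF lip, of v]
      unfolding euclidean_representation by eventually_elim simp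
  qed
  then show ?thesis
  proof (rule eventually_mono)
    fix x assume x: "\<forall>v\<in>D. ((\<lambda>s. (f (x + s *\<^sub>R v) - f x) / s) \<longlongrightarrow> (\<Sum>b\<in>Basis. (v \<bullet> b) * ddiff f b x)) (at 0)"
    define L where "L v = (\<Sum>b\<in>Basis. (v \<bullet> b) * ddiff f b x)" for v
    have bl: "bounded_linear L" unfolding L_def
      by (intro bounded_linear_sum bounded_linear_mult_left[THEN bounded_linear_compose] bounded_linear_inner_left)
    then obtain M where M: "\<And>v. \<bar>L v\<bar> \<le> norm v * M" "0 \<le> M" 
      using bounded_linear.nonneg_bounded[OF bl] by auto
    interpret L: bounded_linear L by fact
    have K: "0 \<le> K * norm v" for v :: 'a using dq_bound[of 0 0 v] by linarith
    obtain b :: 'a where "norm b = 1" using vector_choose_size[of 1] by auto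
    then have K0: "0 \<le> K" using K[of b] by simp
    have "(f has_derivative L) (at x)"
      unfolding has_derivative_at_alt
    proof (intro conjI bl allI impI)
      fix e :: real assume e: "0 < e"
      \<comment> \<open>The error per unit length has three parts: \<open>\<epsilon>\<close> from
        the quotient in direction \<open>v\<close>, \<open>K * \<epsilon>\<close> from moving
        \<open>f\<close> between the directions \<open>w\<close> and \<open>v\<close>, and
        \<open>M * \<epsilon>\<close> from moving \<open>L\<close>.\<close>
      define \<epsilon> where "\<epsilon> = e / (K + M + 1)"
      have \<epsilon>: "0 < \<epsilon>" using e K0 M by (simp add: \<epsilon>_def)
      have "sphere 0 1 \<subseteq> (\<Union>v\<in>D. ball v \<epsilon>)"
      proof
        fix w :: 'a
        obtain v where "v \<in> D" "v \<in> ball w \<epsilon>" using D(2)[of "ball w \<epsilon>"] \<epsilon> by auto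
        then show "w \<in> (\<Union>v\<in>D. ball v \<epsilon>)" by (auto simp: dist_commute)
      qed
      then have cover: "sphere 0 1 \<subseteq> (\<Union>v\<in>D. ball v \<epsilon>)" .
      obtain F where F: "F \<subseteq> D" "finite F" "sphere 0 1 \<subseteq> (\<Union>v\<in>F. ball v \<epsilon>)"
        by (rule compactE_image[OF compact_sphere _ cover]) auto
      have "\<forall>\<^sub>F s in at 0. \<forall>v\<in>F. \<bar>(f (x + s *\<^sub>R v) - f x) / s - L v\<bar> < \<epsilon>"
      proof (intro eventually_ball_finite F ballI)
        fix v assume "v \<in> F"
        then show "\<forall>\<^sub>F s in at 0. \<bar>(f (x + s *\<^sub>R v) - f x) / s - L v\<bar> < \<epsilon>"
          using tendstoD[OF bspec[OF x] \<epsilon>, of v] F(1) unfolding L_def dist_real_def by auto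
      qed
      then obtain d where d: "0 < d" "\<And>s v. s \<noteq> 0 \<Longrightarrow> \<bar>s\<bar> < d \<Longrightarrow> v \<in> F \<Longrightarrow> \<bar>(f (x + s *\<^sub>R v) - f x) / s - L v\<bar> < \<epsilon>"
        unfolding eventually_at dist_real_def by auto
      show "\<exists>d>0. \<forall>y. norm (y - x) < d \<longrightarrow> norm (f y - f x - L (y - x)) \<le> e * norm (y - x)"
      proof (intro exI[of _ d] conjI allI impI d)
        fix y assume y: "norm (y - x) < d"
        show "norm (f y - f x - L (y - x)) \<le> e * norm (y - x)"
        proof (cases "y = x")
          case False
          define s where "s = norm (y - x)"
          define w where "w = (y - x) /\<^sub>R s"
          have s: "0 < s" "s < d" using False y by (auto simp: s_def)
          have "norm w = 1" using s by (simp add: w_def s_def)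
          then have "w \<in> (\<Union>v\<in>F. ball v \<epsilon>)" by (intro subsetD[OF F(3)]) simp
          then obtain v where v: "v \<in> F" "norm (w - v) < \<epsilon>" by (auto simp: dist_norm norm_minus_commute)
          have yw: "y = x + s *\<^sub>R w" "y - x = s *\<^sub>R w" using s by (simp_all add: w_def)
          have "(f (x + s *\<^sub>R v) - f x) - s * L v = s * ((f (x + s *\<^sub>R v) - f x) / s - L v)"
            using s by (simp add: field_simps)
          then have 1: "\<bar>(f (x + s *\<^sub>R v) - f x) - s * L v\<bar> \<le> s * \<epsilon>"
            using d(2)[of s v] s v by (simp add: abs_mult)
          have "\<bar>f (x + s *\<^sub>R w) - f (x + s *\<^sub>R v)\<bar> \<le> K * (s * norm (w - v))"
            using lip[of "x + s *\<^sub>R w" "x + s *\<^sub>R v"] s by (simp add: scaleR_diff_right[symmetric])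
          also have "\<dots> \<le> K * (s * \<epsilon>)" using K0 s v by (intro mult_left_mono) auto
          finally have 2: "\<bar>f (x + s *\<^sub>R w) - f (x + s *\<^sub>R v)\<bar> \<le> K * (s * \<epsilon>)" .
          have "\<bar>s * L v - s * L w\<bar> = s * \<bar>L (w - v)\<bar>"
            using s by (simp add: L.diff abs_mult right_diff_distrib[symmetric])
          also have "\<dots> \<le> s * (norm (w - v) * M)" using M s by (intro mult_left_mono) auto
          also have "\<dots> \<le> s * (\<epsilon> * M)" using M s v by (intro mult_left_mono mult_right_mono) auto
          finally have 3: "\<bar>s * L v - s * L w\<bar> \<le> s * (\<epsilon> * M)" .
          have "\<bar>f (x + s *\<^sub>R w) - f x - s * L w\<bar> \<le> s * \<epsilon> + K * (s * \<epsilon>) + s * (\<epsilon> * M)"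
            using 1 2 3 by linarith
          also have "\<dots> = s * (\<epsilon> * (K + M + 1))" by (simp add: algebra_simps)
          also have "\<epsilon> * (K + M + 1) = e" using K0 M by (simp add: \<epsilon>_def)
          finally show ?thesis unfolding s_def[symmetric] unfolding yw by (simp add: L.scaleR mult.commute)
        qed (simp add: L.zero)
      qed
    qed
    then show "\<exists>L. (f has_derivative L) (at x)" by blast
  qed
qed

end

theorem rademacher:
  fixes F :: "'a::euclidean_space \<Rightarrow> 'b::euclidean_space"
  assumes lip: "\<And>x y. norm (F x - F y) \<le> K * norm (x - y)"
  shows "AE x in lborel. F differentiable at x"
proof -
  have "AE x in lborel. \<forall>b\<in>Basis. \<exists>L. ((\<lambda>x. F x \<bullet> b) has_derivative L) (at x)"
  proof (intro AE_finite_allI AE_differentiable_real)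
    fix b :: 'b and x y assume "b \<in> Basis"
    then have "\<bar>(F x - F y) \<bullet> b\<bar> \<le> norm (F x - F y)" by (rule Basis_le_norm)
    also have "\<dots> \<le> K * norm (x - y)" by (rule lip)
    finally show "\<bar>F x \<bullet> b - F y \<bullet> b\<bar> \<le> K * norm (x - y)" by (simp add: inner_diff_left)
  qed simp
  then show ?thesis
  proof (rule eventually_mono)
    fix x assume "\<forall>b\<in>Basis. \<exists>L. ((\<lambda>x. F x \<bullet> b) has_derivative L) (at x)"
    then have "\<forall>b\<in>Basis. (\<lambda>x. F x \<bullet> b) differentiable at x" by (simp add: differentiable_def)
    then show "F differentiable at x" using differentiable_componentwise_within[of F x UNIV] by simp
  qed
qed

section \<open>Almost everywhere complex differentiable Lipschitz functions are affine\<close>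

lemma AE_lborel_translate:
  fixes P :: "'a::euclidean_space \<Rightarrow> bool"
  assumes "AE x in lborel. P x"
  shows "AE x in lborel. P (a + x)"
proof -
  have "AE x in distr lborel borel ((+) a). P x" unfolding lborel_distr_plus by (rule assms)
  then show ?thesis by (rule AE_distrD[rotated]) simp
qed

text \<open>Nothing is known on the line through a given \<open>a\<close>, but for each
  \<open>w\<close> differentiability holds at \<open>a + g w + t\<close> for almost all
  \<open>t\<close>. So the integral over a ball of radius \<open>r\<close> is entire in
  \<open>w\<close>, and it grows linearly. Two real directions \<open>h\<close> and \<open>k\<close>
  replace a complex structure on the domain; \<open>k\<close> stands for \<open>\<i>\<close> times
  \<open>h\<close>.\<close>

lemma affine_on_complex_line_if_AE_field_differentiable:
  fixes \<phi> :: "'a::euclidean_space \<Rightarrow> complex" and h k :: 'a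
  defines "g \<equiv> \<lambda>z::complex. Re z *\<^sub>R h + Im z *\<^sub>R k"
  assumes lip: "\<And>x y. norm (\<phi> x - \<phi> y) \<le> K * norm (x - y)"
    and diff: "AE x in lborel. \<exists>c. ((\<lambda>z. \<phi> (x + g z)) has_field_derivative c) (at 0)"
  shows "\<phi> (a + g z) = \<phi> a + z * (\<phi> (a + h) - \<phi> a)"
proof -
  have lin: "g (z + w) = g z + g w" "g 0 = 0" "g 1 = h" for z w
    by (auto simp: g_def algebra_simps)
  define N where "N = norm h + norm k"
  have gn: "norm (g z) \<le> N * norm z" for z
  proof -
    have "norm (g z) \<le> \<bar>Re z\<bar> * norm h + \<bar>Im z\<bar> * norm k"
      unfolding g_def by (rule order_trans[OF norm_triangle_ineq]) simp
    also have "\<dots> \<le> norm z * norm h + norm z * norm k"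
      by (intro add_mono mult_right_mono abs_Re_le_cmod abs_Im_le_cmod) auto
    finally show ?thesis by (simp add: N_def algebra_simps)
  qed
  obtain b :: 'a where "norm b = 1" using vector_choose_size[of 1] by auto
  then have K: "0 \<le> K" using lip[of b 0] norm_ge_zero[of "\<phi> b - \<phi> 0"] by (simp del: norm_ge_zero)
  have N: "0 \<le> N" by (simp add: N_def)
  have cont: "continuous_on UNIV \<phi>"
    using lip K by (intro lipschitz_on_continuous_on[of K]) (auto simp: lipschitz_on_def dist_norm)
  have [measurable]: "\<phi> \<in> borel_measurable borel" using cont by (rule borel_measurable_continuous_onI)
  have lipg: "norm (\<phi> (x + g z) - \<phi> x) \<le> K * N * norm z" for x z
  proof -
    have "norm (\<phi> (x + g z) - \<phi> x) \<le> K * norm (g z)" using lip[of "x + g z" x] by simp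
    also have "\<dots> \<le> K * (N * norm z)" using gn K by (rule mult_left_mono)
    finally show ?thesis by simp
  qed
  \<comment> \<open>A sequential limit, as for \<open>ddiff\<close>, so that \<open>c\<close> is
    measurable and may stand under the integral.\<close>
  define c where "c x = lim (\<lambda>n. (\<phi> (x + g (1 / of_nat (Suc n))) - \<phi> x) / (1 / of_nat (Suc n)))" for x
  have [measurable]: "c \<in> borel_measurable borel" unfolding c_def by measurable
  have AEc: "AE x in lborel. ((\<lambda>z. (\<phi> (x + g z) - \<phi> x) / z) \<longlongrightarrow> c x) (at 0)"
    using diff
  proof (rule eventually_mono)
    fix x assume "\<exists>c. ((\<lambda>z. \<phi> (x + g z)) has_field_derivative c) (at 0)"
    then obtain d where d: "((\<lambda>z. (\<phi> (x + g z) - \<phi> x) / z) \<longlongrightarrow> d) (at 0)"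
      unfolding has_field_derivative_iff using lin by auto
    have "(\<lambda>n. 1 / of_nat (Suc n) :: complex) \<longlonglongrightarrow> 0"
      using LIMSEQ_Suc[OF lim_1_over_n[where 'a = complex]] by simp
    then have "filterlim (\<lambda>n. 1 / of_nat (Suc n) :: complex) (at 0) sequentially"
      unfolding filterlim_at by (auto simp del: of_nat_Suc)
    from filterlim_compose[OF d this] have "c x = d" unfolding c_def by (rule limI)
    with d show "((\<lambda>z. (\<phi> (x + g z) - \<phi> x) / z) \<longlongrightarrow> c x) (at 0)" by simp
  qed
  \<comment> \<open>Replacing \<open>\<phi>\<close> by its average costs at most
    \<open>K * r\<close> at each point compared, so the defect of affinity is proportional to
    \<open>r\<close>. The integral \<open>G\<close> is not normalised, hence the factors
    \<open>V\<close>.\<close>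
  have bound: "norm (\<phi> (a + g z) - \<phi> a - z * (\<phi> (a + h) - \<phi> a)) \<le> r * (K * (2 + 2 * norm z))" if r: "0 < r" for r
  proof -
    define I where "I t = (indicator (cball 0 r) t :: real)" for t :: 'a
    have [measurable]: "I \<in> borel_measurable borel" 
      using borel_measurable_indicator[of "cball (0::'a) r" borel] by (simp add: I_def[abs_def])
    have fin: "emeasure lborel (cball (0::'a) r) < \<infinity>"
      using emeasure_lborel_cball_finite[of "0::'a" r] by (simp add: less_top[symmetric])
    have iI: "integrable lborel I" unfolding I_def using fin by (intro integrable_real_indicator) auto
    define V where "V = (\<integral>t. I t \<partial>lborel)"
    have V: "0 < V" using content_cball_pos[OF r, of "0::'a"] by (simp add: V_def I_def)
    define G where "G w = (\<integral>t. I t *\<^sub>R \<phi> (a + g w + t) \<partial>lborel)" for w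
    have iG: "integrable lborel (\<lambda>t. I t *\<^sub>R \<phi> (b + t))" for b
    proof (rule Bochner_Integration.integrable_bound)
      show "integrable lborel (\<lambda>t. (norm (\<phi> b) + K * r) * I t)" using iI by simp
      show "AE t in lborel. norm (I t *\<^sub>R \<phi> (b + t)) \<le> norm ((norm (\<phi> b) + K * r) * I t)"
      proof (rule AE_I2)
        fix t :: 'a
        have "norm (\<phi> (b + t)) \<le> norm (\<phi> b) + K * norm t"
          using lip[of "b + t" b] norm_triangle_ineq2[of "\<phi> (b + t)" "\<phi> b"] by simp
        also have "K * norm t \<le> K * r" if "t \<in> cball 0 r" using that K by (intro mult_left_mono) auto
        finally show "norm (I t *\<^sub>R \<phi> (b + t)) \<le> norm ((norm (\<phi> b) + K * r) * I t)"
          using K r by (auto simp: I_def indicator_def)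
      qed
    qed measurable
    have near: "norm (G w - V *\<^sub>R \<phi> (a + g w)) \<le> V * (K * r)" for w
    proof -
      have "V *\<^sub>R \<phi> (a + g w) = (\<integral>t. I t *\<^sub>R \<phi> (a + g w) \<partial>lborel)"
        unfolding V_def using iI by (simp add: integral_scaleR_left)
      then have "G w - V *\<^sub>R \<phi> (a + g w) = (\<integral>t. I t *\<^sub>R \<phi> (a + g w + t) - I t *\<^sub>R \<phi> (a + g w) \<partial>lborel)"
        unfolding G_def using iG[of "a + g w"] iI by simp
      also have "norm \<dots> \<le> (\<integral>t. I t * (K * r) \<partial>lborel)"
      proof (rule Bochner_Integration.integral_norm_bound_integral)
        show "integrable lborel (\<lambda>t. I t *\<^sub>R \<phi> (a + g w + t) - I t *\<^sub>R \<phi> (a + g w))"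
          using iG[of "a + g w"] iI by simp
        show "norm (I t *\<^sub>R \<phi> (a + g w + t) - I t *\<^sub>R \<phi> (a + g w)) \<le> I t * (K * r)" for t
        proof (cases "t \<in> cball 0 r")
          case True
          then have "K * norm t \<le> K * r" using K by (intro mult_left_mono) auto
          then show ?thesis using lip[of "a + g w + t" "a + g w"] True by (simp add: I_def)
        qed (simp add: I_def)
      qed (use iI in simp)
      also have "\<dots> = V * (K * r)" by (simp add: V_def)
      finally show ?thesis .
    qed
    have der: "(G has_field_derivative (\<integral>t. I t *\<^sub>R c (a + g w + t) \<partial>lborel)) (at w)" for w
      unfolding has_field_derivative_iff
    proof -
      let ?b = "a + g w"
      have "((\<lambda>u. (G (w + u) - G w) / u) \<longlongrightarrow> (\<integral>t. I t *\<^sub>R c (?b + t) \<partial>lborel)) (at 0)"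
        unfolding tendsto_at_iff_sequentially
      proof (intro allI impI)
        fix X :: "nat \<Rightarrow> complex"
        assume X: "\<forall>i. X i \<in> UNIV - {0}" "X \<longlonglongrightarrow> 0"
        have fX: "filterlim X (at 0) sequentially" unfolding filterlim_at using X by auto
        have eq: "(G (w + X n) - G w) / X n = (\<integral>t. I t *\<^sub>R ((\<phi> (?b + t + g (X n)) - \<phi> (?b + t)) / X n) \<partial>lborel)" for n
        proof -
          have "(\<integral>t. I t *\<^sub>R ((\<phi> (?b + t + g (X n)) - \<phi> (?b + t)) / X n) \<partial>lborel)
            = (\<integral>t. (I t *\<^sub>R \<phi> (?b + g (X n) + t) - I t *\<^sub>R \<phi> (?b + t)) / X n \<partial>lborel)"
            by (intro Bochner_Integration.integral_cong) (auto simp: scaleR_conv_of_real right_diff_distrib diff_divide_distrib add_ac)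
          also have "\<dots> = ((\<integral>t. I t *\<^sub>R \<phi> (?b + g (X n) + t) \<partial>lborel) - (\<integral>t. I t *\<^sub>R \<phi> (?b + t) \<partial>lborel)) / X n"
            by (simp add: Bochner_Integration.integral_diff[OF iG iG])
          finally show ?thesis by (simp add: G_def lin add_ac)
        qed
        have "(\<lambda>n. (\<integral>t. I t *\<^sub>R ((\<phi> (?b + t + g (X n)) - \<phi> (?b + t)) / X n) \<partial>lborel)) \<longlonglongrightarrow> (\<integral>t. I t *\<^sub>R c (?b + t) \<partial>lborel)"
        proof (rule integral_dominated_convergence)
          show "integrable lborel (\<lambda>t. I t * (K * N))" using iI by simp
          show "AE t in lborel. (\<lambda>n. I t *\<^sub>R ((\<phi> (?b + t + g (X n)) - \<phi> (?b + t)) / X n)) \<longlonglongrightarrow> I t *\<^sub>R c (?b + t)"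
            using AE_lborel_translate[OF AEc, of ?b]
          proof eventually_elim
            case (elim t)
            show ?case by (intro tendsto_intros filterlim_compose[OF elim fX])
          qed
          show "AE t in lborel. norm (I t *\<^sub>R ((\<phi> (?b + t + g (X n)) - \<phi> (?b + t)) / X n)) \<le> I t * (K * N)" for n
          proof (rule AE_I2)
            fix t
            have "norm ((\<phi> (?b + t + g (X n)) - \<phi> (?b + t)) / X n) \<le> K * N"
              using lipg[of "?b + t" "X n"] X(1) by (simp add: norm_divide field_simps)
            moreover have "0 \<le> I t" by (simp add: I_def)
            ultimately show "norm (I t *\<^sub>R ((\<phi> (?b + t + g (X n)) - \<phi> (?b + t)) / X n)) \<le> I t * (K * N)"
              by (simp add: mult_left_mono)
          qed
        qed measurable
        then show "((\<lambda>u. (G (w + u) - G w) / u) \<circ> X) \<longlonglongrightarrow> (\<integral>t. I t *\<^sub>R c (?b + t) \<partial>lborel)"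
          by (simp add: o_def eq)
      qed
      then show "((\<lambda>y. (G y - G w) / (y - w)) \<longlongrightarrow> (\<integral>t. I t *\<^sub>R c (?b + t) \<partial>lborel)) (at w)"
        using LIM_offset_zero_iff[of w "\<lambda>y. (G y - G w) / (y - w)"] by simp
    qed
    then have hol: "G holomorphic_on UNIV"
      by (intro holomorphic_onI) (auto simp: field_differentiable_def)
    \<comment> \<open>Linear growth, written with exponent 1, leaves only the terms of degree 0 and
      1 in Liouville's theorem.\<close>
    have growth: "norm (G w) \<le> (norm (G 0) + V * (2 * (K * r)) + V * (K * N)) * norm w ^ 1" if w: "1 \<le> norm w" for w
    proof -
      have A: "norm (V *\<^sub>R \<phi> (a + g w) - V *\<^sub>R \<phi> a) \<le> V * (K * N * norm w)"
        using lipg[of a w] V by (simp add: scaleR_diff_right[symmetric])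
      have four: "norm (p + q - s + t) \<le> norm p + norm q + norm s + norm t" for p q s t :: complex
        using norm_triangle_ineq[of "p + q - s" t] norm_triangle_ineq4[of "p + q" s] norm_triangle_ineq[of p q] by simp
      have B: "norm (G w) \<le> norm (G w - V *\<^sub>R \<phi> (a + g w)) + norm (V *\<^sub>R \<phi> (a + g w) - V *\<^sub>R \<phi> a) + norm (G 0 - V *\<^sub>R \<phi> a) + norm (G 0)"
        using four[of "G w - V *\<^sub>R \<phi> (a + g w)" "V *\<^sub>R \<phi> (a + g w) - V *\<^sub>R \<phi> a" "G 0 - V *\<^sub>R \<phi> a" "G 0"] by simp
      have C: "norm (G 0 - V *\<^sub>R \<phi> a) \<le> V * (K * r)" using near[of 0] lin(2) by simp
      have "norm (G w) \<le> V * (K * r) + V * (K * N * norm w) + V * (K * r) + norm (G 0)"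
        using A B C near[of w] by linarith
      moreover have "1 * (norm (G 0) + V * (2 * (K * r))) \<le> norm w * (norm (G 0) + V * (2 * (K * r)))"
        using w V K r by (intro mult_right_mono) auto
      ultimately show ?thesis by (simp add: algebra_simps)
    qed
    have AB: "G w = G 0 + deriv G 0 * w" for w
      using Liouville_polynomial[OF hol growth, where \<xi> = w] by simp
    have "G z - G 0 = z * (G 1 - G 0)" using AB[of z] AB[of 1] by simp
    then have "V *\<^sub>R (\<phi> (a + g z) - \<phi> a - z * (\<phi> (a + h) - \<phi> a)) =
        - (G z - V *\<^sub>R \<phi> (a + g z)) + (G 0 - V *\<^sub>R \<phi> (a + g 0)) + z * (G 1 - V *\<^sub>R \<phi> (a + g 1)) - z * (G 0 - V *\<^sub>R \<phi> (a + g 0))"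
      by (simp add: lin scaleR_diff_right algebra_simps)
    also have "norm \<dots> \<le> V * (K * r) + V * (K * r) + norm z * (V * (K * r)) + norm z * (V * (K * r))"
    proof -
      have tri: "norm (- a + b + c - d) \<le> norm a + norm b + norm c + norm d" for a b c d :: complex
        using norm_triangle_ineq4[of "- a + b + c" d] norm_triangle_ineq[of "- a + b" c]
          norm_triangle_ineq[of "- a" b] by simp
      have z: "norm (z * u) \<le> norm z * (V * (K * r))" if "norm u \<le> V * (K * r)" for u
        using that by (simp add: norm_mult mult_left_mono)
      show ?thesis
        by (rule order_trans[OF tri]) (intro add_mono near z)
    qed
    also have "\<dots> = V * (r * (K * (2 + 2 * norm z)))" by (simp add: algebra_simps)
    finally show ?thesis using V by simp
  qed
  have "norm (\<phi> (a + g z) - \<phi> a - z * (\<phi> (a + h) - \<phi> a)) \<le> 0"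
  proof (rule tendsto_lowerbound)
    show "((\<lambda>r. r * (K * (2 + 2 * norm z))) \<longlongrightarrow> 0) (at_right 0)" by (auto intro!: tendsto_eq_intros)
    show "\<forall>\<^sub>F r in at_right 0. norm (\<phi> (a + g z) - \<phi> a - z * (\<phi> (a + h) - \<phi> a)) \<le> r * (K * (2 + 2 * norm z))"
      by (rule eventually_mono[OF eventually_at_right_less]) (rule bound)
  qed simp
  then show ?thesis by (simp add: algebra_simps)
qed

section \<open>Polynomial functions\<close>

definition polyfun :: "(complex \<Rightarrow> complex) \<Rightarrow> bool" where
  "polyfun f \<longleftrightarrow> (\<exists>p. \<forall>z. f z = poly p z)"

lemma polyfun_const [simp]: "polyfun (\<lambda>z. c)"
  unfolding polyfun_def by (intro exI[of _ "[:c:]"]) simp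

lemma polyfun_id [simp]: "polyfun (\<lambda>z. z)"
  unfolding polyfun_def by (intro exI[of _ "[:0, 1:]"]) simp

lemma polyfun_add: "polyfun f \<Longrightarrow> polyfun g \<Longrightarrow> polyfun (\<lambda>z. f z + g z)"
  unfolding polyfun_def by (metis poly_add)

lemma polyfun_diff: "polyfun f \<Longrightarrow> polyfun g \<Longrightarrow> polyfun (\<lambda>z. f z - g z)"
  unfolding polyfun_def by (metis poly_diff)

lemma polyfun_mult: "polyfun f \<Longrightarrow> polyfun g \<Longrightarrow> polyfun (\<lambda>z. f z * g z)"
  unfolding polyfun_def by (metis poly_mult)

lemma polyfun_sum: "(\<And>i. i \<in> I \<Longrightarrow> polyfun (f i)) \<Longrightarrow> polyfun (\<lambda>z. \<Sum>i\<in>I. f i z)"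
  by (induction I rule: infinite_finite_induct) (auto intro: polyfun_add)

lemma polyfun_prod: "(\<And>i. i \<in> I \<Longrightarrow> polyfun (f i)) \<Longrightarrow> polyfun (\<lambda>z. \<Prod>i\<in>I. f i z)"
  by (induction I rule: infinite_finite_induct) (auto intro: polyfun_mult)

lemma polyfun_if: "(b \<Longrightarrow> polyfun f) \<Longrightarrow> (\<not> b \<Longrightarrow> polyfun g) \<Longrightarrow> polyfun (\<lambda>z. if b then f z else g z)"
  by (cases b) auto

lemmas polyfun_intros = polyfun_const polyfun_id polyfun_add polyfun_diff polyfun_mult polyfun_sum polyfun_prod polyfun_if

lemma polyfun_eq_0_if_infinite_zeros:
  assumes "polyfun f" "infinite {z. f z = 0}"
  shows "f z = 0"
proof -
  obtain p where p: "\<And>z. f z = poly p z" using assms(1) by (auto simp: polyfun_def)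
  then have "p = 0" using poly_roots_finite[of p] assms(2) by auto
  then show ?thesis using p by simp
qed

text \<open>Polynomial dependence on finitely many variables is only used through restriction to complex lines.\<close>

definition linepoly :: "(('k \<Rightarrow> complex) \<Rightarrow> complex) \<Rightarrow> bool" where
  "linepoly f \<longleftrightarrow> (\<forall>P Q. polyfun (\<lambda>z. f (\<lambda>k. P k + z * Q k)))"

lemma linepolyD: "linepoly f \<Longrightarrow> polyfun (\<lambda>z. f (\<lambda>k. P k + z * Q k))"
  by (simp add: linepoly_def)

text \<open>On the line from a common non-root for \<open>I\<close> to a non-root of the new
  function, none of the restrictions vanishes identically, so each has finitely many zeros and some
  point avoids them all.\<close>

lemma linepoly_common_nonzero:
  assumes "finite I" "\<And>i. i \<in> I \<Longrightarrow> linepoly (f i)" "\<And>i. i \<in> I \<Longrightarrow> \<exists>P. f i P \<noteq> 0"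
  shows "\<exists>P. \<forall>i\<in>I. f i P \<noteq> 0"
  using assms
proof (induction I rule: finite_induct)
  case (insert j I)
  then obtain P where P: "\<forall>i\<in>I. f i P \<noteq> 0" by auto
  obtain Q where Q: "f j Q \<noteq> 0" using insert.prems by auto
  define \<gamma> where "\<gamma> z = (\<lambda>k. P k + z * (Q k - P k))" for z
  have g: "\<gamma> 0 = P" "\<gamma> 1 = Q" by (auto simp: \<gamma>_def)
  have pf: "polyfun (\<lambda>z. f i (\<gamma> z))" if "i \<in> insert j I" for i
    unfolding \<gamma>_def using linepolyD[OF insert.prems(1)[OF that], of P "\<lambda>k. Q k - P k"] .
  have fin: "finite {z. f i (\<gamma> z) = 0}" if i: "i \<in> insert j I" for i
  proof (rule ccontr)
    assume "\<not> ?thesis"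
    then have z: "f i (\<gamma> z) = 0" for z using polyfun_eq_0_if_infinite_zeros[OF pf[OF i]] by blast
    show False using z[of 0] z[of 1] g P Q i by auto
  qed
  have "finite (\<Union>i\<in>insert j I. {z. f i (\<gamma> z) = 0})" using fin insert.hyps by blast
  then obtain z where "z \<notin> (\<Union>i\<in>insert j I. {z. f i (\<gamma> z) = 0})"
    using ex_new_if_finite[OF infinite_UNIV_char_0] by blast
  then show ?case by auto
qed simp

text \<open>A polynomial vanishing on the real form cut out by \<open>P (\<tau> k) = cnj (P k)\<close> vanishes identically,
  since every point lies on a complex line whose real points are in the real form.\<close>

lemma linepoly_eq_0_if_eq_0_on_real_form:
  fixes P :: "'k \<Rightarrow> complex"
  assumes f: "linepoly f" and \<tau>: "\<And>k. \<tau> (\<tau> k) = k"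
    and 0: "\<And>P. (\<And>k. P (\<tau> k) = cnj (P k)) \<Longrightarrow> f P = 0"
  shows "f P = 0"
proof -
  \<comment> \<open>Real and imaginary part of \<open>P\<close> for the conjugation defining the
    real form; the parameter \<open>\<i>\<close> recovers \<open>P\<close>.\<close>
  define a where "a k = (P k + cnj (P (\<tau> k))) / 2" for k
  define b where "b k = (P k - cnj (P (\<tau> k))) / (2 * \<i>)" for k
  have a: "a (\<tau> k) = cnj (a k)" for k by (simp add: a_def \<tau>)
  have b: "b (\<tau> k) = cnj (b k)" for k by (simp add: b_def \<tau> field_simps)
  define g where "g z = f (\<lambda>k. a k + z * b k)" for z
  have pf: "polyfun g" using f unfolding linepoly_def g_def by blast
  have "g (of_real x) = 0" for x unfolding g_def by (rule 0) (simp add: a b)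
  then have "range complex_of_real \<subseteq> {z. g z = 0}" by auto
  moreover have "infinite (range complex_of_real)"
    using infinite_UNIV_char_0[where 'a = real] by (simp add: finite_image_iff inj_of_real)
  ultimately have "infinite {z. g z = 0}" using finite_subset by blast
  then have "g \<i> = 0" using polyfun_eq_0_if_infinite_zeros[OF pf] by blast
  moreover have "(\<lambda>k. a k + \<i> * b k) = P" by (auto simp: a_def b_def field_simps)
  ultimately show ?thesis by (simp add: g_def)
qed

section \<open>Complex matrices\<close>

definition csm :: "complex \<Rightarrow> complex^'n^'m \<Rightarrow> complex^'n^'m" where
  "csm c X = (\<chi> i j. c * X $ i $ j)"

definition cnjm :: "complex^'n^'m \<Rightarrow> complex^'n^'m" where
  "cnjm X = (\<chi> i j. cnj (X $ i $ j))"

definition munit :: "'n \<Rightarrow> 'm \<Rightarrow> complex^'m^'n" where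
  "munit i j = (\<chi> a b. if a = i \<and> b = j then 1 else 0)"

definition diagm :: "('n \<Rightarrow> complex) \<Rightarrow> complex^'n^'n" where
  "diagm d = (\<chi> i j. if i = j then d i else 0)"

lemma csm_nth [simp]: "csm c X $ i $ j = c * X $ i $ j" by (simp add: csm_def)
lemma cnjm_nth [simp]: "cnjm X $ i $ j = cnj (X $ i $ j)" by (simp add: cnjm_def)
lemma munit_nth [simp]: "munit i j $ a $ b = (if a = i \<and> b = j then 1 else 0)" by (simp add: munit_def)
lemma diagm_nth [simp]: "diagm d $ i $ j = (if i = j then d i else 0)" by (simp add: diagm_def)
lemma mat_nth: "mat c $ i $ j = (if i = j then c else 0)" by (simp add: mat_def)
lemma mult_nth: "(A ** B) $ i $ j = (\<Sum>k\<in>UNIV. A $ i $ k * B $ k $ j)" by (simp add: matrix_matrix_mult_def)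

lemma mult_diff: "A ** (B - C) = A ** B - A ** C" "(B - C) ** A = B ** A - C ** (A :: complex^'n^'n)"
  by (auto simp: vec_eq_iff mult_nth sum_subtractf algebra_simps)

lemma csm_simps: "csm c (X + Y) = csm c X + csm c Y" "csm c (X - Y) = csm c X - csm c Y"
    "csm (a + b) X = csm a X + csm b X" "csm a (csm b X) = csm (a * b) X" "csm 0 X = 0" "csm 1 X = X"
    "csm c 0 = 0" "csm (-1) X = - X"
  by (auto simp: vec_eq_iff algebra_simps)

lemma csm_mult: "csm c A ** B = csm c (A ** B)" "A ** csm c B = csm c (A ** B)"
  by (auto simp: vec_eq_iff mult_nth sum_distrib_left mult_ac)

lemma trace_csm: "trace (csm c X) = c * trace X"
  by (simp add: trace_def sum_distrib_left)

lemma csm_real: "csm (of_real r) X = r *\<^sub>R X"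
  by (simp add: vec_eq_iff) (simp add: scaleR_conv_of_real)

lemma csm_Re_Im: "csm z X = Re z *\<^sub>R X + Im z *\<^sub>R csm \<i> X"
  by (auto simp: vec_eq_iff complex_eq_iff)

definition clin :: "(complex^'n^'n \<Rightarrow> complex^'n^'n) \<Rightarrow> bool" where
  "clin A \<longleftrightarrow> (\<forall>X Y. A (X + Y) = A X + A Y) \<and> (\<forall>c X. A (csm c X) = csm c (A X))"

lemma clinD: "clin A \<Longrightarrow> A (X + Y) = A X + A Y" "clin A \<Longrightarrow> A (csm c X) = csm c (A X)"
  by (auto simp: clin_def)

lemma clin_0: "clin A \<Longrightarrow> A 0 = 0"
  using clinD(2)[of A 0 0] by (simp add: csm_simps)

lemma clin_sum: "clin A \<Longrightarrow> A (\<Sum>i\<in>I. f i) = (\<Sum>i\<in>I. A (f i))"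
  by (induction I rule: infinite_finite_induct) (auto simp: clin_0 clinD)

lemma clin_diff: "clin A \<Longrightarrow> A (X - Y) = A X - A Y"
  using clinD(1)[of A X "csm (-1) Y"] clinD(2)[of A "-1" Y] by (simp add: csm_simps)

lemma munit_sum: "X = (\<Sum>i\<in>UNIV. \<Sum>j\<in>UNIV. csm (X $ i $ j) (munit i j))"
proof -
  have "(\<Sum>i\<in>UNIV. \<Sum>j\<in>UNIV. csm (X $ i $ j) (munit i j)) $ a $ b = X $ a $ b" for a b
  proof -
    have "(\<Sum>i\<in>UNIV. \<Sum>j\<in>UNIV. csm (X $ i $ j) (munit i j)) $ a $ b
       = (\<Sum>i\<in>UNIV. \<Sum>j\<in>UNIV. if a = i \<and> b = j then X $ i $ j else 0)"
      by (auto simp: intro!: sum.cong)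
    also have "\<dots> = (\<Sum>i\<in>UNIV. if a = i then X $ i $ b else 0)"
      by (intro sum.cong) auto
    finally show ?thesis by simp
  qed
  then show ?thesis by (auto simp: vec_eq_iff)
qed

lemma clin_expand: "clin A \<Longrightarrow> A X = (\<Sum>i\<in>UNIV. \<Sum>j\<in>UNIV. csm (X $ i $ j) (A (munit i j)))"
  by (subst munit_sum[of X]) (simp add: clin_sum clinD)

section \<open>Matrices depending polynomially on a parameter\<close>

definition matpoly :: "(complex \<Rightarrow> complex^'n^'m) \<Rightarrow> bool" where
  "matpoly M \<longleftrightarrow> (\<forall>i j. polyfun (\<lambda>z. M z $ i $ j))"

lemma matpolyD: "matpoly M \<Longrightarrow> polyfun (\<lambda>z. M z $ i $ j)" by (auto simp: matpoly_def)

lemma matpoly_const: "matpoly (\<lambda>z. X)" by (simp add: matpoly_def)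

lemma matpoly_add: "matpoly M \<Longrightarrow> matpoly N \<Longrightarrow> matpoly (\<lambda>z. M z + N z)"
  and matpoly_diff: "matpoly M \<Longrightarrow> matpoly N \<Longrightarrow> matpoly (\<lambda>z. M z - N z)"
  by (auto simp: matpoly_def intro: polyfun_intros)

lemma matpoly_csm: "polyfun f \<Longrightarrow> matpoly N \<Longrightarrow> matpoly (\<lambda>z. csm (f z) (N z))"
  by (auto simp: matpoly_def intro: polyfun_intros)

lemma matpoly_mult: "matpoly M \<Longrightarrow> matpoly N \<Longrightarrow> matpoly (\<lambda>z. M z ** N z)"
  by (auto simp: matpoly_def mult_nth intro!: polyfun_sum polyfun_mult)

lemma matpoly_mat: "polyfun f \<Longrightarrow> matpoly (\<lambda>z. mat (f z))"
  by (auto simp: matpoly_def mat_nth intro!: polyfun_if)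

lemma matpoly_clin: "clin A \<Longrightarrow> matpoly M \<Longrightarrow> matpoly (\<lambda>z. A (M z))"
proof -
  assume A: "clin A" and M: "matpoly M"
  have "(\<lambda>z. A (M z) $ a $ b) = (\<lambda>z. \<Sum>i\<in>UNIV. \<Sum>j\<in>UNIV. M z $ i $ j * A (munit i j) $ a $ b)" for a b
    by (subst clin_expand[OF A]) simp
  then show ?thesis using M by (auto simp: matpoly_def intro!: polyfun_sum polyfun_mult)
qed

lemma polyfun_det: "matpoly M \<Longrightarrow> polyfun (\<lambda>z. det (M z))"
  unfolding det_def by (intro polyfun_sum polyfun_mult polyfun_prod matpolyD polyfun_const)

lemma polyfun_trace: "matpoly M \<Longrightarrow> polyfun (\<lambda>z. trace (M z))"
  unfolding trace_def by (intro polyfun_sum matpolyD)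

text \<open>The adjugate in the form of Cramer's rule, with column \<open>k\<close> replaced by a
  unit vector. Unlike \<open>matrix_inv\<close> it is polynomial in the entries of
  \<open>s\<close>.\<close>

definition adjm :: "complex^'n^'n \<Rightarrow> complex^'n^'n" where
  "adjm s = (\<chi> k j. det (\<chi> i l. if l = k then axis j 1 $ i else s $ i $ l))"

lemma matpoly_adjm: "matpoly M \<Longrightarrow> matpoly (\<lambda>z. adjm (M z))"
  unfolding matpoly_def[of "\<lambda>z. adjm (M z)"] adjm_def
  by (auto intro!: polyfun_det polyfun_if simp: matpoly_def)

lemma inv_inverse:
  assumes "invertible (A :: complex^'n^'n)"
  shows "A ** matrix_inv A = mat 1" "matrix_inv A ** A = mat 1"
  using someI_ex[of "\<lambda>A'. A ** A' = mat 1 \<and> A' ** A = mat 1"] assms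
  unfolding invertible_def matrix_inv_def by auto

lemma inv_unique:
  assumes "A ** B = mat 1" 
  shows "matrix_inv (A :: complex^'n^'n) = B"
proof -
  have "invertible A" using assms invertible_right_inverse by blast
  then have "matrix_inv A = matrix_inv A ** (A ** B)" using assms by simp
  also have "\<dots> = (matrix_inv A ** A) ** B" by (simp add: matrix_mul_assoc)
  finally show ?thesis using inv_inverse[OF \<open>invertible A\<close>] by simp
qed

lemma mult_axis_nth: "(A *v axis j 1) $ i = (A :: complex^'n^'n) $ i $ j"
  by (simp add: matrix_vector_mult_def axis_def if_distrib cong: if_cong)

lemma adjm_eq:
  assumes "invertible s"
  shows "adjm s = csm (det s) (matrix_inv s)"
proof -
  have d: "det s \<noteq> 0" using assms by (simp add: invertible_det_nz)
  have "adjm s $ k $ j = det s * matrix_inv s $ k $ j" for k j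
  proof -
    have "s *v (matrix_inv s *v axis j 1) = axis j 1"
      by (simp add: matrix_vector_mul_assoc inv_inverse[OF assms])
    then have "matrix_inv s *v axis j 1 = (\<chi> k. det (\<chi> i l. if l = k then axis j 1 $ i else s $ i $ l) / det s)"
      using cramer[OF d] by blast
    then have "matrix_inv s $ k $ j = adjm s $ k $ j / det s"
      unfolding mult_axis_nth[symmetric, of "matrix_inv s"] by (simp add: adjm_def)
    then show ?thesis using d by simp
  qed
  then show ?thesis by (simp add: vec_eq_iff)
qed

lemma mat_mult_vec: "mat c *v v = c *s (v :: complex^'n)"
  by (simp add: vec_eq_iff matrix_vector_mult_def mat_nth if_distrib if_distribR cong: if_cong)

lemma matrix_vector_sum: "A *v (\<Sum>k\<in>S. f k) = (\<Sum>k\<in>S. A *v (f k :: complex^'n))"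
  by (induction S rule: infinite_finite_induct) (auto simp: matrix_vector_right_distrib)

lemma mat_spectrum_iff_det: "c \<in> mat_spectrum A \<longleftrightarrow> det (A - mat c) = 0"
proof -
  have "(A - mat c) *v v = A *v v - c *s v" for v
    by (simp add: matrix_vector_mult_diff_rdistrib mat_mult_vec)
  then have "c \<in> mat_spectrum A \<longleftrightarrow> (\<exists>v. v \<noteq> 0 \<and> (A - mat c) *v v = 0)"
    by (simp add: mat_spectrum_def)
  also have "\<dots> \<longleftrightarrow> \<not> invertible (A - mat c)"
    unfolding invertible_left_inverse matrix_left_invertible_ker by blast
  finally show ?thesis by (simp add: invertible_det_nz)
qed

section \<open>Diagonalisable matrices\<close>

definition simd :: "complex^'n^'n \<Rightarrow> ('n \<Rightarrow> complex) \<Rightarrow> complex^'n^'n" where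
  "simd s d = s ** diagm d ** matrix_inv s"

lemma mult_diagm_nth: "(s ** diagm d) $ i $ k = s $ i $ k * d k"
proof -
  have "(s ** diagm d) $ i $ k = (\<Sum>l\<in>UNIV. if k = l then s $ i $ k * d k else 0)"
    unfolding mult_nth by (intro sum.cong) auto
  then show ?thesis by simp
qed

lemma diagm_mult: "diagm d ** diagm e = diagm (\<lambda>i. d i * e i)"
  by (auto simp: vec_eq_iff mult_diagm_nth)

lemma simd_mult:
  assumes "invertible s"
  shows "simd s d ** simd s e = simd s (\<lambda>i. d i * e i)"
proof -
  have "simd s d ** simd s e = s ** diagm d ** (matrix_inv s ** s) ** diagm e ** matrix_inv s"
    by (simp add: simd_def matrix_mul_assoc)
  also have "\<dots> = s ** (diagm d ** diagm e) ** matrix_inv s"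
    by (simp add: inv_inverse[OF assms] matrix_mul_assoc)
  finally show ?thesis by (simp add: diagm_mult simd_def)
qed

lemma trace_simd:
  assumes "invertible s"
  shows "trace (simd s d) = (\<Sum>i\<in>UNIV. d i)"
proof -
  have "trace (simd s d) = trace (matrix_inv s ** (s ** diagm d))"
    unfolding simd_def by (rule trace_mul_sym)
  also have "\<dots> = trace (diagm d)" by (simp add: matrix_mul_assoc inv_inverse[OF assms])
  finally show ?thesis by (simp add: trace_def)
qed

lemma csm_simd: "csm c (simd s d) = simd s (\<lambda>i. c * d i)"
proof -
  have "csm c (diagm d) = diagm (\<lambda>i. c * d i)" by (auto simp: vec_eq_iff)
  then show ?thesis unfolding simd_def by (metis csm_mult)
qed

lemma det_simd_diff:
  assumes "invertible s"
  shows "det (simd s d - mat c) = (\<Prod>i\<in>UNIV. d i - c)"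
proof -
  have e: "diagm d - mat c = diagm (\<lambda>i. d i - c)" by (auto simp: vec_eq_iff mat_nth)
  have m: "s ** mat c ** matrix_inv s = mat c"
  proof -
    have "mat c = csm c (mat 1 :: complex^'a^'a)" by (auto simp: vec_eq_iff mat_nth)
    then show ?thesis using inv_inverse[OF assms] by (simp add: csm_mult)
  qed
  have "s ** (diagm d - mat c) ** matrix_inv s = simd s d - mat c"
    unfolding simd_def by (subst m[symmetric]) (simp add: mult_diff)
  then have "det (simd s d - mat c) = det s * det (diagm d - mat c) * det (matrix_inv s)"
    by (metis det_mul)
  also have "\<dots> = det (diagm d - mat c) * det (s ** matrix_inv s)" by (simp add: det_mul)
  also have "\<dots> = det (diagm (\<lambda>i. d i - c))" using inv_inverse[OF assms] by (simp add: e)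
  also have "\<dots> = (\<Prod>i\<in>UNIV. d i - c)" by (subst det_diagonal) auto
  finally show ?thesis .
qed

lemma mat_spectrum_simd:
  assumes "invertible s"
  shows "mat_spectrum (simd s d) = range d"
  by (auto simp: set_eq_iff mat_spectrum_iff_det det_simd_diff[OF assms])

lemma eq_simd_if_distinct_eigenvalues:
  assumes d: "inj d" "\<And>k. d k \<in> mat_spectrum h"
  obtains s where "invertible s" "h = simd s d"
proof -
  have "\<forall>k. \<exists>v. v \<noteq> 0 \<and> h *v v = d k *s v" using d(2) by (auto simp: mat_spectrum_def)
  then obtain v where v: "\<And>k. v k \<noteq> 0" "\<And>k. h *v v k = d k *s v k"
    using choice[of "\<lambda>k v. v \<noteq> 0 \<and> h *v v = d k *s v"] by blast
  have ind: "\<forall>k\<in>S. c k = 0" if "finite S" "(\<Sum>k\<in>S. c k *s v k) = 0" for S c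
    using that
  proof (induction S arbitrary: c rule: finite_induct)
    case (insert x S)
    define w where "w = c x *s v x + (\<Sum>k\<in>S. c k *s v k)"
    have w: "w = 0" using insert by (simp add: w_def)
    have "h *v w = (c x * d x) *s v x + (\<Sum>k\<in>S. (c k * d k) *s v k)"
      by (simp add: w_def matrix_vector_right_distrib matrix_vector_sum vector_scalar_commute v vector_smult_assoc)
    then have 1: "(c x * d x) * v x $ i + (\<Sum>k\<in>S. (c k * d k) * v k $ i) = 0" for i
      by (simp add: w vec_eq_iff)
    have 2: "c x * v x $ i + (\<Sum>k\<in>S. c k * v k $ i) = 0" for i
      using arg_cong[OF w, of "\<lambda>w. w $ i"] by (simp add: w_def)
    \<comment> \<open>Subtracting \<open>d x\<close> times the relation from its image under
      \<open>h\<close> removes \<open>v x\<close> and multiplies every other coefficient by the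
      nonzero number \<open>d k - d x\<close>.\<close>
    have "(\<Sum>k\<in>S. (c k * (d k - d x)) * v k $ i) = 0" for i
    proof -
      have "(\<Sum>k\<in>S. (c k * (d k - d x)) * v k $ i) =
          (\<Sum>k\<in>S. (c k * d k) * v k $ i) - d x * (\<Sum>k\<in>S. c k * v k $ i)"
        by (simp add: sum_distrib_left sum_subtractf[symmetric] algebra_simps)
      also have "\<dots> = (c x * d x * v x $ i + (\<Sum>k\<in>S. (c k * d k) * v k $ i)) - d x * (c x * v x $ i + (\<Sum>k\<in>S. c k * v k $ i))"
        by (simp add: algebra_simps)
      finally show ?thesis by (simp only: 1 2 mult_zero_right diff_0_right)
    qed
    then have "(\<Sum>k\<in>S. (c k * (d k - d x)) *s v k) = 0" by (simp add: vec_eq_iff)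
    then have "\<forall>k\<in>S. c k * (d k - d x) = 0" by (rule insert.IH)
    moreover have "d k - d x \<noteq> 0" if "k \<in> S" for k
      using that insert.hyps injD[OF d(1), of k x] by auto
    ultimately have S: "\<forall>k\<in>S. c k = 0" by auto
    then have "c x *s v x = 0" using w by (simp add: w_def)
    then show ?case using S v(1) by simp
  qed simp
  define s where "s = (\<chi> i k. v k $ i)"
  have col: "column k s = v k" for k by (simp add: s_def column_def vec_eq_iff)
  have "x = 0" if "s *v x = 0" for x
  proof -
    have "(\<Sum>k\<in>UNIV. (x $ k) *s v k) = 0" using that by (simp add: matrix_mult_sum col)
    from ind[OF finite_class.finite_UNIV this] have "x $ k = 0" for k by blast
    then show ?thesis by (simp add: vec_eq_iff)
  qed
  then have inv: "invertible s" unfolding invertible_left_inverse matrix_left_invertible_ker by blast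
  have "h ** s = s ** diagm d"
  proof -
    have "(h ** s) $ i $ k = (s ** diagm d) $ i $ k" for i k
    proof -
      have "(h ** s) $ i $ k = (h *v v k) $ i" by (simp add: mult_nth s_def matrix_vector_mult_def)
      also have "\<dots> = (s ** diagm d) $ i $ k"
        by (simp add: v mult_diagm_nth s_def mult.commute)
      finally show ?thesis .
    qed
    then show ?thesis by (simp add: vec_eq_iff)
  qed
  then have "simd s d = h ** (s ** matrix_inv s)" by (simp add: simd_def matrix_mul_assoc)
  then have "h = simd s d" using inv_inverse[OF inv] by simp
  with inv that show ?thesis by blast
qed

section \<open>Real linear maps sharing an eigenvalue with each argument\<close>

lemma mult_add: "A ** (B + C) = A ** B + A ** C" "(B + C) ** A = B ** A + C ** (A :: complex^'n^'n)"
  by (auto simp: vec_eq_iff mult_nth sum.distrib algebra_simps)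

lemma cnjm_cnjm [simp]: "cnjm (cnjm X) = X" by (simp add: vec_eq_iff)

lemma cnjm_mult: "cnjm (A ** B) = cnjm A ** cnjm B"
  by (simp add: vec_eq_iff mult_nth)

lemma det_cnjm: "det (cnjm A) = cnj (det A)"
  by (simp add: det_def)

lemma cnjm_diagm: "cnjm (diagm d) = diagm (\<lambda>i. cnj (d i))"
  by (auto simp: vec_eq_iff)

lemma cnjm_adjm: "cnjm (adjm s) = adjm (cnjm s)"
proof -
  have "cnj (adjm s $ k $ j) = adjm (cnjm s) $ k $ j" for k j
  proof -
    have "cnj (adjm s $ k $ j) = det (cnjm (\<chi> i l. if l = k then axis j 1 $ i else s $ i $ l))"
      by (simp add: adjm_def det_cnjm)
    also have "cnjm (\<chi> i l. if l = k then axis j 1 $ i else s $ i $ l) = (\<chi> i l. if l = k then axis j 1 $ i else cnjm s $ i $ l)"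
      by (auto simp: vec_eq_iff axis_def)
    finally show ?thesis by (simp add: adjm_def)
  qed
  then show ?thesis by (simp add: vec_eq_iff)
qed

text \<open>Near a diagonal matrix with distinct entries the minimum modulus principle yields an eigenvalue
  close to each of these entries.\<close>

lemma ex_ball_distinct_eigenvalues:
  "\<exists>h0 :: complex^'n^'n. \<exists>\<delta>>0. \<forall>h. norm (h - h0) < \<delta> \<longrightarrow> (\<exists>s d. invertible s \<and> inj d \<and> h = simd s d)"
proof -
  obtain \<nu> :: "'n \<Rightarrow> nat" where \<nu>: "inj \<nu>"
    using finite_imp_inj_to_nat_seg[OF finite_class.finite_UNIV] by blast
  \<comment> \<open>Distinct naturals lie at distance at least 1, so the discs of radius 1/3 below
    are disjoint and one root from each gives distinct eigenvalues.\<close>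
  define d0 where "d0 i = complex_of_nat (\<nu> i)" for i
  have far: "1 \<le> norm (d0 i - d0 j)" if "i \<noteq> j" for i j
  proof -
    have "d0 i - d0 j = of_int (int (\<nu> i) - int (\<nu> j))" by (simp add: d0_def)
    moreover have "int (\<nu> i) - int (\<nu> j) \<noteq> 0" using \<nu> that by (auto simp: inj_def)
    ultimately show ?thesis by (simp only: norm_of_int)
  qed
  define h0 where "h0 = diagm d0"
  define \<Phi> where "\<Phi> p = det (fst p - mat (snd p))" for p :: "(complex^'n^'n) \<times> complex"
  have "simd (mat 1) d0 = h0"
    using inv_unique[of "mat 1" "mat 1 :: complex^'n^'n"] by (simp add: simd_def h0_def)
  moreover have "invertible (mat 1 :: complex^'n^'n)" by (simp add: invertible_det_nz)
  ultimately have \<Phi>0: "\<Phi> (h0, z) = (\<Prod>i\<in>UNIV. d0 i - z)" for z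
    using det_simd_diff[of "mat 1" d0 z] by (simp add: \<Phi>_def)
  have cont: "continuous_on UNIV \<Phi>"
  proof -
    have "continuous_on UNIV (\<lambda>p :: (complex^'n^'n) \<times> complex. (fst p - mat (snd p)) $ i $ j)" for i j :: 'n
    proof (cases "i = j")
      case True
      then show ?thesis by (auto simp: mat_nth intro!: continuous_on_diff continuous_on_component continuous_on_fst continuous_on_snd continuous_on_id)
    next
      case False
      then show ?thesis by (auto simp: mat_nth intro!: continuous_on_diff continuous_on_component continuous_on_fst continuous_on_snd continuous_on_id)
    qed
    then show ?thesis unfolding \<Phi>_def det_def
      by (intro continuous_on_sum continuous_on_mult continuous_on_prod continuous_on_const)
  qed
  have hol: "(\<lambda>z. \<Phi> (h, z)) holomorphic_on S" for h S
  proof -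
    have "polyfun (\<lambda>z. \<Phi> (h, z))" unfolding \<Phi>_def fst_conv snd_conv
      by (intro polyfun_det matpoly_diff matpoly_const matpoly_mat polyfun_id)
    then obtain p where "(\<lambda>z. \<Phi> (h, z)) = poly p" by (auto simp: polyfun_def)
    then show ?thesis 
      by (simp add: holomorphic_intros)
  qed
  have ex: "\<exists>\<delta>>0. \<forall>h. norm (h - h0) < \<delta> \<longrightarrow> (\<exists>z\<in>cball (d0 k) (1/3). \<Phi> (h, z) = 0)" for k
  proof -
    have "\<exists>x\<in>sphere (d0 k) (1/3). \<forall>y\<in>sphere (d0 k) (1/3). norm (\<Phi> (h0, x)) \<le> norm (\<Phi> (h0, y))"
      by (intro continuous_attains_inf continuous_on_norm holomorphic_on_imp_continuous_on hol) auto
    then obtain x where x: "x \<in> sphere (d0 k) (1/3)" "\<And>y. y \<in> sphere (d0 k) (1/3) \<Longrightarrow> norm (\<Phi> (h0, x)) \<le> norm (\<Phi> (h0, y))"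
      by blast
    define m where "m = norm (\<Phi> (h0, x))"
    have "d0 i \<noteq> x" for i
    proof
      assume "d0 i = x"
      then have "norm (d0 k - d0 i) = 1/3" using x by (simp add: dist_norm)
      then show False using far[of k i] by (cases "k = i") auto
    qed
    then have m: "0 < m" by (simp add: m_def \<Phi>0)
    define Q where "Q = cball h0 1 \<times> cball (d0 k) (1/3)"
    have "compact Q" by (auto simp: Q_def intro: compact_Times)
    then have "uniformly_continuous_on Q \<Phi>"
      using cont by (intro compact_uniformly_continuous continuous_on_subset[OF cont]) auto
    then obtain \<delta> where \<delta>: "\<delta> > 0" "\<And>p q. p \<in> Q \<Longrightarrow> q \<in> Q \<Longrightarrow> dist p q < \<delta> \<Longrightarrow> dist (\<Phi> p) (\<Phi> q) < m / 2"
      using uniformly_continuous_onE[of Q \<Phi> "m / 2"] m by (auto simp: dist_commute)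
    have "\<exists>z\<in>cball (d0 k) (1/3). \<Phi> (h, z) = 0" if h: "norm (h - h0) < min \<delta> 1" for h
    proof (rule ccontr)
      assume "\<not> ?thesis"
      then have nz: "\<Phi> (h, z) \<noteq> 0" if "z \<in> cball (d0 k) (1/3)" for z using that by blast
      have close: "norm (\<Phi> (h, z) - \<Phi> (h0, z)) < m / 2" if "z \<in> cball (d0 k) (1/3)" for z
        using \<delta>(2)[of "(h, z)" "(h0, z)"] that h
        by (auto simp: Q_def dist_norm norm_minus_commute dist_Pair_Pair)
      \<comment> \<open>Without a zero in the disc the reciprocal would be holomorphic there and at
        most \<open>2 / m\<close> on the boundary, hence at the centre; but
        \<open>\<Phi> (h0, d0 k) = 0\<close> makes it larger than \<open>2 / m\<close> at the
        centre.\<close>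
      have "norm (1 / \<Phi> (h, d0 k)) \<le> 2 / m"
      proof (rule maximum_modulus_frontier[of "\<lambda>z. 1 / \<Phi> (h, z)" "cball (d0 k) (1/3)"])
        show "(\<lambda>z. 1 / \<Phi> (h, z)) holomorphic_on interior (cball (d0 k) (1/3))"
          by (intro holomorphic_intros hol) (use nz in auto)
        show "continuous_on (closure (cball (d0 k) (1/3))) (\<lambda>z. 1 / \<Phi> (h, z))"
          by (intro continuous_intros holomorphic_on_imp_continuous_on hol) (use nz in auto)
        show "norm (1 / \<Phi> (h, z)) \<le> 2 / m" if "z \<in> frontier (cball (d0 k) (1/3))" for z
        proof -
          have z: "z \<in> sphere (d0 k) (1/3)" using that by simp
          have "m \<le> norm (\<Phi> (h0, z))" using x(2)[OF z] by (simp add: m_def)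
          moreover have "norm (\<Phi> (h0, z)) \<le> norm (\<Phi> (h, z)) + norm (\<Phi> (h, z) - \<Phi> (h0, z))"
            by (metis norm_minus_commute norm_triangle_sub)
          ultimately have "m / 2 \<le> norm (\<Phi> (h, z))" using close[of z] z by auto
          then show ?thesis using m frac_le[of 1 1 "m / 2" "norm (\<Phi> (h, z))"] by (simp add: norm_divide)
        qed
      qed auto
      moreover have "norm (\<Phi> (h, d0 k)) < m / 2"
      proof -
        have "\<Phi> (h0, d0 k) = 0" unfolding \<Phi>0 by (rule prod_zero) auto
        then show ?thesis using close[of "d0 k"] by simp
      qed
      moreover have "0 < norm (\<Phi> (h, d0 k))" using nz by simp
      ultimately show False using m by (simp add: norm_divide field_simps)
    qed
    then show ?thesis using \<delta>(1) by (intro exI[of _ "min \<delta> 1"]) auto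
  qed
  then obtain \<delta> where \<delta>: "\<And>k. \<delta> k > 0" "\<And>k h. norm (h - h0) < \<delta> k \<Longrightarrow> \<exists>z\<in>cball (d0 k) (1/3). \<Phi> (h, z) = 0"
    using choice[of "\<lambda>k \<delta>. \<delta> > 0 \<and> (\<forall>h. norm (h - h0) < \<delta> \<longrightarrow> (\<exists>z\<in>cball (d0 k) (1/3). \<Phi> (h, z) = 0))"] by blast
  have "\<exists>s d. invertible s \<and> inj d \<and> h = simd s d" if h: "norm (h - h0) < Min (range \<delta>)" for h
  proof -
    have "norm (h - h0) < \<delta> k" for k using h by simp
    then have "\<forall>k. \<exists>z. z \<in> cball (d0 k) (1/3) \<and> \<Phi> (h, z) = 0" using \<delta>(2) by blast
    then obtain d where d: "\<And>k. d k \<in> cball (d0 k) (1/3)" "\<And>k. \<Phi> (h, d k) = 0"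
      using choice[of "\<lambda>k z. z \<in> cball (d0 k) (1/3) \<and> \<Phi> (h, z) = 0"] by blast
    have "inj d"
    proof (rule injI, rule ccontr)
      fix i j assume ij: "d i = d j" "i \<noteq> j"
      have "dist (d0 i) (d0 j) \<le> dist (d0 i) (d i) + dist (d0 j) (d j)"
        unfolding ij by (rule dist_triangle2)
      also have "\<dots> \<le> 1/3 + 1/3" using d(1)[of i] d(1)[of j] by (intro add_mono) auto
      finally show False using far[OF ij(2)] by (simp add: dist_norm)
    qed
    moreover have "d k \<in> mat_spectrum h" for k using d(2)[of k] by (simp add: \<Phi>_def mat_spectrum_iff_det)
    ultimately show ?thesis using eq_simd_if_distinct_eigenvalues by blast
  qed
  moreover have "0 < Min (range \<delta>)" using \<delta>(1) by (simp add: Min_gr_iff)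
  ultimately show ?thesis by blast
qed

lemma polyfun_eq_0_if_eq_0_near_0:
  fixes h k :: "complex^'n^'n"
  assumes f: "polyfun f" and \<delta>: "0 < \<delta>"
    and 0: "\<And>z. norm (csm z h) < \<delta> \<Longrightarrow> norm (csm z k) < \<delta> \<Longrightarrow> f z = 0"
  shows "f z = 0"
proof -
  have lim: "((\<lambda>z. norm (csm z x)) \<longlongrightarrow> 0) (at 0)" for x :: "complex^'n^'n"
  proof -
    have "((\<lambda>z. norm (Re z *\<^sub>R x + Im z *\<^sub>R csm \<i> x)) \<longlongrightarrow> norm (Re 0 *\<^sub>R x + Im 0 *\<^sub>R csm \<i> x)) (at 0)"
      by (intro tendsto_intros)
    then show ?thesis by (simp only: csm_Re_Im[symmetric]) (simp add: csm_simps)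
  qed
  have "\<forall>\<^sub>F z in at 0. f z = 0"
    using order_tendstoD(2)[OF lim[of h] \<delta>] order_tendstoD(2)[OF lim[of k] \<delta>]
    by eventually_elim (rule 0)
  then obtain \<epsilon> where "0 < \<epsilon>" "\<And>z. z \<noteq> 0 \<Longrightarrow> norm z < \<epsilon> \<Longrightarrow> f z = 0"
    unfolding eventually_at dist_norm diff_0_right by blast
  then have "ball 0 \<epsilon> - {0} \<subseteq> {z. f z = 0}" by auto
  moreover have "infinite (ball 0 \<epsilon> - {0 :: complex})"
    using countable_finite uncountable_ball[OF \<open>0 < \<epsilon>\<close>, of "0 :: complex"] by (intro infinite_remove) auto
  ultimately have "infinite {z. f z = 0}" by (rule infinite_super)
  then show ?thesis by (rule polyfun_eq_0_if_infinite_zeros[OF f])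
qed

section \<open>Nondegeneracy of the trace form\<close>

lemma trace_munit: "trace (munit i j ** X) = X $ j $ i"
proof -
  have "(munit i j ** X) $ a $ a = (if a = i then X $ j $ i else 0)" for a
  proof -
    have "(munit i j ** X) $ a $ a = (\<Sum>b\<in>UNIV. if b = j then (if a = i then X $ j $ i else 0) else 0)"
      unfolding mult_nth by (intro sum.cong) auto
    then show ?thesis by simp
  qed
  then show ?thesis by (simp add: trace_def)
qed

lemma matrix_eq_0_if_trace_0:
  fixes B :: "complex^'n^'n"
  assumes "\<And>X. trace (X ** B) = 0"
  shows "B = 0"
proof -
  have "B $ j $ i = 0" for i j using assms[of "munit i j"] by (simp add: trace_munit)
  then show ?thesis by (simp add: vec_eq_iff)
qed

lemma clin_trace_polarized:
  assumes A: "clin A" and tr: "\<And>h. trace (A h ** A h) = trace (h ** h)"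
  shows "trace (A h ** A k) = trace (h ** k)"
proof -
  have "trace (A (h + k) ** A (h + k)) = trace ((h + k) ** (h + k))" by (rule tr)
  then have "trace (A h ** A k) + trace (A k ** A h) = trace (h ** k) + trace (k ** h)"
    using tr[of h] tr[of k]
    by (simp add: clinD[OF A] mult_add trace_add add_ac)
  then show ?thesis by (simp add: trace_mul_sym[of "A k"] trace_mul_sym[of k])
qed

text \<open>A linear map preserving a nondegenerate form has trivial kernel, and in finite dimension
  an injective endomorphism is onto.\<close>

lemma clin_surj_if_trace_preserving:
  assumes A: "clin A" and tr: "\<And>h. trace (A h ** A h) = trace (h ** h)"
  shows "surj A"
proof -
  have "linear A"
  proof (rule linearI)
    show "A (r *\<^sub>R X) = r *\<^sub>R A X" for r X
      using clinD(2)[OF A, of "of_real r" X] by (simp add: csm_real)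
  qed (rule clinD[OF A])
  moreover have "inj A"
    unfolding linear_injective_0[OF \<open>linear A\<close>]
  proof (intro allI impI)
    fix h assume h: "A h = 0"
    have "trace (X ** h) = 0" for X
    proof -
      have "trace (X ** h) = trace (A X ** A h)" by (rule clin_trace_polarized[OF A tr, symmetric])
      then show ?thesis by (simp add: h trace_def)
    qed
    then show "h = 0" by (rule matrix_eq_0_if_trace_0)
  qed
  ultimately show ?thesis by (rule linear_injective_imp_surjective) (rule refl)
qed

context
  fixes T :: "complex^'n^'n \<Rightarrow> complex^'n^'n"
  assumes T_add: "\<And>X Y. T (X + Y) = T X + T Y"
    and T_scaleR: "\<And>r X. T (r *\<^sub>R X) = r *\<^sub>R T X"
    and T_spec: "\<And>h. mat_spectrum (T h) \<inter> mat_spectrum h \<noteq> {}"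
begin

text \<open>The complex linear part of \<open>T\<close>, and its conjugate linear part precomposed with conjugation.\<close>

definition linear_part :: "complex^'n^'n \<Rightarrow> complex^'n^'n" where
  "linear_part X = csm (1/2) (T X - csm \<i> (T (csm \<i> X)))"

definition conj_part :: "complex^'n^'n \<Rightarrow> complex^'n^'n" where
  "conj_part X = csm (1/2) (T (cnjm X) + csm \<i> (T (csm \<i> (cnjm X))))"

lemma T_csm: "T (csm c X) = Re c *\<^sub>R T X + Im c *\<^sub>R T (csm \<i> X)"
  by (subst csm_Re_Im) (simp add: T_add T_scaleR)

lemma T_i_csm: "T (csm \<i> (csm c X)) = Re c *\<^sub>R T (csm \<i> X) - Im c *\<^sub>R T X"
proof -
  have "csm \<i> (csm c X) = Re c *\<^sub>R csm \<i> X + (- Im c) *\<^sub>R X"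
    by (simp add: vec_eq_iff complex_eq_iff)
  then show ?thesis by (simp only: T_add T_scaleR) simp
qed

lemma T_decomp: "T X = linear_part X + conj_part (cnjm X)"
  by (simp add: linear_part_def conj_part_def vec_eq_iff field_simps)

lemma clin_linear_part: "clin linear_part"
  unfolding clin_def
proof (intro conjI allI)
  show "linear_part (X + Y) = linear_part X + linear_part Y" for X Y
    by (simp add: linear_part_def T_add csm_simps)
  show "linear_part (csm c X) = csm c (linear_part X)" for c X
    unfolding linear_part_def T_i_csm[of c X] T_csm[of c X]
    by (simp add: vec_eq_iff complex_eq_iff field_simps)
qed

lemma clin_conj_part: "clin conj_part"
  unfolding clin_def
proof (intro conjI allI)
  have "cnjm (X + Y) = cnjm X + cnjm Y" for X Y :: "complex^'n^'n" by (simp add: vec_eq_iff)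
  then show "conj_part (X + Y) = conj_part X + conj_part Y" for X Y
    by (simp add: conj_part_def T_add csm_simps)
  have c: "cnjm (csm c X) = csm (cnj c) (cnjm X)" for c and X :: "complex^'n^'n" by (simp add: vec_eq_iff)
  show "conj_part (csm c X) = csm c (conj_part X)" for c X
    unfolding conj_part_def c T_i_csm[of "cnj c" "cnjm X"] T_csm[of "cnj c" "cnjm X"]
    by (simp add: vec_eq_iff complex_eq_iff field_simps)
qed

text \<open>A point of the parameter space is a pair of tuples \<open>(s, d)\<close> and \<open>(r, e)\<close> of a matrix and a
  diagonal, the flag \<open>True\<close> marking the first. On the real form the second is the conjugate of the first.\<close>

lemma ex_identical_eigenvalue:
  "\<exists>i. \<forall>s d r e. invertible s \<longrightarrow> invertible r \<longrightarrow>
     det (linear_part (simd s d) + conj_part (simd r e) - mat (d i)) = 0"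
proof -
  define sm :: "(('n \<times> 'n + 'n) \<times> bool \<Rightarrow> complex) \<Rightarrow> bool \<Rightarrow> complex^'n^'n"
    where "sm P b = (\<chi> i j. P (Inl (i, j), b))" for P b
  define dv :: "(('n \<times> 'n + 'n) \<times> bool \<Rightarrow> complex) \<Rightarrow> bool \<Rightarrow> 'n \<Rightarrow> complex"
    where "dv P b i = P (Inr i, b)" for P b i
  \<comment> \<open>The adjugate in place of the inverse keeps \<open>H\<close> polynomial in the
    parameters. It multiplies the eigenvalues by \<open>det (sm P b)\<close>, so this factor
    reappears in \<open>g\<close>.\<close>
  define H where "H P b = sm P b ** diagm (dv P b) ** adjm (sm P b)" for P b
  define g where "g P i = det (linear_part (H P True) + conj_part (H P False) - mat (det (sm P True) * dv P True i))" for P i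
  \<comment> \<open>The factor for \<open>None\<close> vanishes where the matrix is singular and
    \<open>H\<close> has no diagonal form, so that the product vanishes on the whole real
    form.\<close>
  define f where "f i P = (case i of None \<Rightarrow> det (sm P True) | Some i \<Rightarrow> g P i)" for i P
  have psm: "matpoly (\<lambda>z. sm (\<lambda>k. P k + z * Q k) b)" for P Q b
    unfolding matpoly_def sm_def by (auto intro!: polyfun_intros)
  have pdv: "polyfun (\<lambda>z. dv (\<lambda>k. P k + z * Q k) b i)" for P Q b i
    unfolding dv_def by (intro polyfun_intros)
  have pdg: "matpoly (\<lambda>z. diagm (dv (\<lambda>k. P k + z * Q k) b))" for P Q b
    unfolding matpoly_def by (auto intro!: polyfun_if pdv)
  have pH: "matpoly (\<lambda>z. H (\<lambda>k. P k + z * Q k) b)" for P Q b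
    unfolding H_def by (intro matpoly_mult matpoly_adjm psm pdg)
  have pf: "linepoly (f i)" for i
    unfolding linepoly_def f_def g_def
    by (cases i) (auto intro!: polyfun_det matpoly_diff matpoly_add matpoly_mat polyfun_mult
        matpoly_clin[OF clin_linear_part] matpoly_clin[OF clin_conj_part] psm pdv pH)
  have Hs: "H P b = simd (sm P b) (\<lambda>i. det (sm P b) * dv P b i)" if "invertible (sm P b)" for P b
    unfolding H_def adjm_eq[OF that] csm_mult simd_def[symmetric] by (simp add: csm_simd)
  have real: "(\<Prod>i\<in>UNIV. f i P) = 0" if P: "\<And>k. P (case k of (i, b) \<Rightarrow> (i, \<not> b)) = cnj (P k)" for P
  proof (cases "invertible (sm P True)")
    case True
    have P': "P (i, False) = cnj (P (i, True))" for i using P[of "(i, True)"] by simp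
    have "sm P False = cnjm (sm P True)" "dv P False = (\<lambda>i. cnj (dv P True i))"
      by (auto simp: sm_def dv_def P' vec_eq_iff)
    then have "H P False = cnjm (H P True)"
      by (simp add: H_def cnjm_mult cnjm_diagm cnjm_adjm)
    then have T: "T (H P True) = linear_part (H P True) + conj_part (H P False)"
      by (simp add: T_decomp[of "H P True"])
    obtain c where c: "c \<in> mat_spectrum (T (H P True))" "c \<in> mat_spectrum (H P True)"
      using T_spec[of "H P True"] by auto
    then obtain i where "c = det (sm P True) * dv P True i"
      unfolding Hs[OF True] mat_spectrum_simd[OF True] by auto
    then have "g P i = 0" using c(1) by (simp add: mat_spectrum_iff_det T g_def)
    then have "f (Some i) P = 0" by (simp add: f_def)
    then show ?thesis using prod_zero[OF finite_class.finite_UNIV, of "\<lambda>i. f i P"] by blast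
  next
    case False
    then have "f None P = 0" by (simp add: f_def invertible_det_nz)
    then show ?thesis using prod_zero[OF finite_class.finite_UNIV, of "\<lambda>i. f i P"] by blast
  qed
  have lp: "linepoly (\<lambda>P. \<Prod>i\<in>UNIV. f i P)"
    unfolding linepoly_def by (auto intro!: polyfun_prod linepolyD[OF pf])
  have prod0: "(\<Prod>i\<in>UNIV. f i P) = 0" for P
    by (rule linepoly_eq_0_if_eq_0_on_real_form[OF lp, of "\<lambda>k. case k of (i, b) \<Rightarrow> (i, \<not> b)"])
      (auto simp: real split: prod.splits)
  \<comment> \<open>If no \<open>g P i\<close> vanished identically, all factors would have a common
    non-root, the determinant factor being nonzero at the identity; the product would then be
    nonzero there.\<close>
  have "\<exists>i. \<forall>P. g P i = 0"
  proof (rule ccontr)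
    assume "\<not> ?thesis"
    then have n: "\<exists>P. f (Some i) P \<noteq> 0" for i by (auto simp: f_def)
    have "sm (\<lambda>k. case k of (Inl (i, j), b) \<Rightarrow> if i = j then 1 else 0 | _ \<Rightarrow> 0) True = mat 1"
      by (auto simp: vec_eq_iff sm_def mat_nth)
    then have "f None (\<lambda>k. case k of (Inl (i, j), b) \<Rightarrow> if i = j then 1 else 0 | _ \<Rightarrow> 0) \<noteq> 0"
      by (simp add: f_def)
    then have "\<exists>P. f i P \<noteq> 0" for i using n by (cases i) auto
    then have "\<exists>P. \<forall>i\<in>UNIV. f i P \<noteq> 0" using pf by (intro linepoly_common_nonzero) auto
    then show False using prod0 by auto
  qed
  then obtain i where i: "\<And>P. g P i = 0" by blast
  have "det (linear_part (simd s d) + conj_part (simd r e) - mat (d i)) = 0"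
    if s: "invertible s" and r: "invertible r" for s d r e
  proof -
    \<comment> \<open>Dividing the diagonals by the determinants cancels the scaling by the
      adjugate, so the two values of \<open>H\<close> are exactly \<open>simd s d\<close> and
      \<open>simd r e\<close>.\<close>
    define P where "P k = (case k of (Inl (i, j), True) \<Rightarrow> s $ i $ j | (Inr i, True) \<Rightarrow> d i / det s
        | (Inl (i, j), False) \<Rightarrow> r $ i $ j | (Inr i, False) \<Rightarrow> e i / det r)" for k
    have "det s \<noteq> 0" "det r \<noteq> 0" using s r by (simp_all add: invertible_det_nz)
    moreover have "sm P True = s" "sm P False = r" by (auto simp: sm_def P_def vec_eq_iff)
    moreover have "dv P True = (\<lambda>i. d i / det s)" "dv P False = (\<lambda>i. e i / det r)"
      by (auto simp: dv_def P_def)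
    ultimately show ?thesis
      using i[of P] Hs[of P True] Hs[of P False] s r by (simp add: g_def)
  qed
  then show ?thesis by blast
qed

text \<open>The identity speaks of one fixed index \<open>i\<close>. Listing the eigenvalues of
  \<open>simd s d\<close> in another order changes only the matrix of eigenvectors, so any
  \<open>d j\<close> can be moved to position \<open>i\<close>; all the distinct values
  \<open>d j\<close> are then eigenvalues of the sum and diagonalise it.\<close>

lemma simd_if_simd_distinct:
  assumes s: "invertible s" and d: "inj d" and r: "invertible r"
  obtains q where "invertible q" "linear_part (simd s d) + conj_part (simd r e) = simd q d"
proof -
  obtain i where i: "\<And>s d r e. invertible s \<Longrightarrow> invertible r \<Longrightarrow>
     det (linear_part (simd s d) + conj_part (simd r e) - mat (d i)) = 0"
    using ex_identical_eigenvalue by blast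
  have "d j \<in> mat_spectrum (linear_part (simd s d) + conj_part (simd r e))" for j
  proof -
    define \<pi> where "\<pi> = Transposition.transpose i j"
    have "inj (d \<circ> \<pi>)" unfolding \<pi>_def using d by (intro inj_compose) auto
    moreover have "(d \<circ> \<pi>) k \<in> mat_spectrum (simd s d)" for k
      by (simp add: mat_spectrum_simd[OF s])
    ultimately obtain s' where s': "invertible s'" "simd s d = simd s' (d \<circ> \<pi>)"
      using eq_simd_if_distinct_eigenvalues by blast
    have "(d \<circ> \<pi>) i = d j" by (simp add: \<pi>_def)
    then show ?thesis using i[OF s'(1) r, of "d \<circ> \<pi>" e] s' by (simp add: mat_spectrum_iff_det)
  qed
  then obtain q where "invertible q" "linear_part (simd s d) + conj_part (simd r e) = simd q d"
    using eq_simd_if_distinct_eigenvalues[OF d] by blast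
  with that show ?thesis by blast
qed

lemma trace_parts:
  "trace ((linear_part h + conj_part k) ** (linear_part h + conj_part k)) = trace (h ** h)" (is "?tr2 h k")
  "trace ((linear_part h + conj_part k) ** (linear_part h + conj_part k) ** (linear_part h + conj_part k))
    = trace (h ** h ** h)" (is "?tr3 h k")
proof -
  obtain h0 :: "complex^'n^'n" and \<delta> where \<delta>: "0 < \<delta>"
      "\<And>h. norm (h - h0) < \<delta> \<Longrightarrow> (\<exists>s d. invertible s \<and> inj d \<and> h = simd s d)"
    using ex_ball_distinct_eigenvalues by blast
  have near: "?tr2 h k \<and> ?tr3 h k" if h: "norm (h - h0) < \<delta>" and k: "norm (k - h0) < \<delta>" for h k
  proof -
    obtain s d where s: "invertible s" "inj d" "h = simd s d" using \<delta>(2)[OF h] by blast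
    obtain r e where r: "invertible r" "k = simd r e" using \<delta>(2)[OF k] by blast
    obtain q where "invertible q" "linear_part (simd s d) + conj_part (simd r e) = simd q d"
      using simd_if_simd_distinct[OF s(1,2) r(1)] by blast
    then have q: "invertible q" "linear_part h + conj_part k = simd q d" by (simp_all add: s(3) r(2))
    show ?thesis unfolding q(2) using s q(1) by (simp add: simd_mult trace_simd)
  qed
  \<comment> \<open>A complex line of pairs from \<open>(h0, h0)\<close> to \<open>(h, k)\<close>:
    the identities hold for small \<open>z\<close>, where both arguments have distinct eigenvalues,
    and therefore at \<open>z = 1\<close>.\<close>
  define X where "X z = linear_part (h0 + csm z (h - h0)) + conj_part (h0 + csm z (k - h0))" for z
  define Y where "Y z = h0 + csm z (h - h0)" for z
  have XY: "matpoly X" "matpoly Y" unfolding X_def Y_def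
    by (intro matpoly_add matpoly_clin[OF clin_linear_part] matpoly_clin[OF clin_conj_part]
        matpoly_const matpoly_csm polyfun_id)+
  have XY1: "X 1 = linear_part h + conj_part k" "Y 1 = h" by (simp_all add: X_def Y_def csm_simps)
  have p2: "polyfun (\<lambda>z. trace (X z ** X z) - trace (Y z ** Y z))"
    and p3: "polyfun (\<lambda>z. trace (X z ** X z ** X z) - trace (Y z ** Y z ** Y z))"
    by (intro polyfun_diff polyfun_trace matpoly_mult XY)+
  have "trace (X z ** X z) - trace (Y z ** Y z) = 0" for z
    by (rule polyfun_eq_0_if_eq_0_near_0[OF p2 \<delta>(1), of "h - h0" "k - h0"]) (simp add: X_def Y_def near)
  from this[of 1] show "?tr2 h k" by (simp add: XY1)
  have "trace (X z ** X z ** X z) - trace (Y z ** Y z ** Y z) = 0" for z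
    by (rule polyfun_eq_0_if_eq_0_near_0[OF p3 \<delta>(1), of "h - h0" "k - h0"]) (simp add: X_def Y_def near)
  from this[of 1] show "?tr3 h k" by (simp add: XY1)
qed

text \<open>As \<open>h\<close> and \<open>k\<close> are independent, the square identity splits:
  \<open>k = 0\<close> shows that \<open>linear_part\<close> preserves the trace form,
  \<open>h = 0\<close> that squares of \<open>conj_part\<close> have trace 0, and so the cross term
  vanishes. Since \<open>linear_part\<close> is onto, \<open>conj_part k\<close> is orthogonal to
  every matrix.\<close>

lemma T_eq_linear_part: "T = linear_part"
proof -
  note L = clin_linear_part and C = clin_conj_part
  have LL: "trace (linear_part h ** linear_part h) = trace (h ** h)" for h
    using trace_parts(1)[of h 0] by (simp add: clin_0[OF C])
  have CC: "trace (conj_part k ** conj_part k) = 0" for k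
    using trace_parts(1)[of 0 k] by (simp add: clin_0[OF L] trace_def)
  have LC: "trace (linear_part h ** conj_part k) = 0" for h k
    using trace_parts(1)[of h k] LL[of h] CC[of k] trace_mul_sym[of "linear_part h" "conj_part k"]
    by (simp add: mult_add trace_add)
  have "surj linear_part" by (rule clin_surj_if_trace_preserving[OF L LL])
  have "conj_part k = 0" for k
  proof (rule matrix_eq_0_if_trace_0)
    fix X :: "complex^'n^'n"
    obtain h where "X = linear_part h" using \<open>surj linear_part\<close> by blast
    then show "trace (X ** conj_part k) = 0" by (simp add: LC)
  qed
  then have "T X = linear_part X" for X by (subst T_decomp) simp
  then show ?thesis by blast
qed

lemma spectral_real_linear:
  "clin T" "trace (T h ** T h) = trace (h ** h)" "trace (T h ** T h ** T h) = trace (h ** h ** h)"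
proof -
  show "clin T" using clin_linear_part by (simp only: T_eq_linear_part[symmetric])
  show "trace (T h ** T h) = trace (h ** h)" "trace (T h ** T h ** T h) = trace (h ** h ** h)"
    using trace_parts[of h 0]
    by (simp_all only: T_eq_linear_part[symmetric] clin_0[OF clin_conj_part] add_0_right)
qed

end

section \<open>Jordan automorphisms of the matrix algebra\<close>

lemma munit_mult: "munit i j ** munit k l = (if j = k then munit i l else 0)"
proof -
  have "(munit i j ** munit k l) $ a $ b = (if j = k then munit i l else 0) $ a $ b" for a b
  proof -
    have "(munit i j ** munit k l) $ a $ b = (\<Sum>c\<in>UNIV. if c = j then (if a = i \<and> c = k \<and> b = l then 1 else 0) else 0)"
      unfolding mult_nth by (intro sum.cong) auto
    then show ?thesis by auto
  qed
  then show ?thesis by (simp add: vec_eq_iff)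
qed

lemma munit_diag_mult_nth: "(munit i i ** X) $ a $ b = (if a = i then X $ a $ b else 0)"
  "(X ** munit i i) $ a $ b = (if b = i then X $ a $ b else 0)"
proof -
  have "(munit i i ** X) $ a $ b = (\<Sum>c\<in>UNIV. if c = i then (if a = i then X $ i $ b else 0) else 0)"
    unfolding mult_nth by (intro sum.cong) auto
  then show "(munit i i ** X) $ a $ b = (if a = i then X $ a $ b else 0)" by simp
  have "(X ** munit i i) $ a $ b = (\<Sum>c\<in>UNIV. if c = i then (if b = i then X $ a $ i else 0) else 0)"
    unfolding mult_nth by (intro sum.cong) auto
  then show "(X ** munit i i) $ a $ b = (if b = i then X $ a $ b else 0)" by simp
qed

text \<open>The part odd in \<open>k\<close> isolates \<open>trace (h ** h ** k)\<close>; the only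
  other term is a pure cube, again preserved by any map that preserves traces of cubes.\<close>

lemma trace_cube_diff:
  fixes h k :: "complex^'n^'n"
  shows "trace ((h + k) ** (h + k) ** (h + k)) - trace ((h - k) ** (h - k) ** (h - k))
    = 6 * trace (h ** h ** k) + 2 * trace (k ** k ** k)"
proof -
  have 1: "trace (h ** k ** h) = trace (h ** h ** k)"
    using trace_mul_sym[of "h ** k" h] by (simp add: matrix_mul_assoc)
  have 2: "trace (k ** h ** h) = trace (h ** h ** k)"
    using trace_mul_sym[of k "h ** h"] by (simp add: matrix_mul_assoc)
  show ?thesis
    by (simp add: mult_add mult_diff trace_add trace_sub 1 2)
qed

text \<open>Cubes give \<open>trace (A h ** A h ** A k) = trace (h ** h ** k)\<close>, and the
  polarised trace form turns the right side into the pairing of \<open>A k\<close> with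
  \<open>A (h ** h)\<close>. Every matrix is some \<open>A k\<close>, so nondegeneracy finishes the
  argument.\<close>

lemma square_if_trace_cube:
  assumes A: "clin A" and t2: "\<And>h. trace (A h ** A h) = trace (h ** h)"
    and t3: "\<And>h. trace (A h ** A h ** A h) = trace (h ** h ** h)"
  shows "A (h ** h) = A h ** A h"
proof -
  have "A (h ** h) - A h ** A h = 0"
  proof (rule matrix_eq_0_if_trace_0)
    fix X
    obtain k where X: "X = A k" using clin_surj_if_trace_preserving[OF A t2] by blast
    have "6 * trace (A h ** A h ** A k) = 6 * trace (h ** h ** k)"
      using trace_cube_diff[of "A h" "A k"] trace_cube_diff[of h k] t3[of "h + k"] t3[of "h - k"] t3[of k]
      by (simp add: clinD(1)[OF A] clin_diff[OF A])
    then have "trace (A k ** (A h ** A h)) = trace (k ** (h ** h))"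
      using trace_mul_sym[of "A k" "A h ** A h"] trace_mul_sym[of k "h ** h"] by simp
    then show "trace (X ** (A (h ** h) - A h ** A h)) = 0"
      by (simp add: X mult_diff trace_sub clin_trace_polarized[OF A t2])
  qed
  then show ?thesis by simp
qed

lemma jordan_if_square:
  assumes A: "clin A" and sq: "\<And>h. A (h ** h) = A h ** A h"
  shows "A (h ** k + k ** h) = A h ** A k + A k ** A h"
proof -
  have "(h + k) ** (h + k) = h ** h + (h ** k + k ** h) + k ** k" by (simp add: mult_add)
  then have "A ((h + k) ** (h + k)) = A (h ** h) + A (h ** k + k ** h) + A (k ** k)"
    by (simp only: clinD(1)[OF A])
  moreover have "A ((h + k) ** (h + k)) = A h ** A h + (A h ** A k + A k ** A h) + A k ** A k"
    unfolding sq clinD(1)[OF A] by (simp add: mult_add)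
  ultimately have "A h ** A h + A (h ** k + k ** h) + A k ** A k = A h ** A h + (A h ** A k + A k ** A h) + A k ** A k"
    by (simp only: sq)
  then show ?thesis by (simp only: add_left_cancel add_right_cancel)
qed

text \<open>The conditions make \<open>\<gamma>\<close> a multiplicative cocycle on pairs of
  indices, hence a quotient \<open>c k / c l\<close> with \<open>c k = \<gamma> k p\<close> for any
  base index \<open>p\<close>. Conjugation by the diagonal matrix of \<open>c\<close> scales matrix
  units by these quotients.\<close>

lemma inner_if_scales_units:
  fixes S :: "complex^'n^'n \<Rightarrow> complex^'n^'n"
  assumes S: "clin S" and g: "\<And>k l. S (munit k l) = csm (\<gamma> k l) (munit k l)"
    and g1: "\<And>k. \<gamma> k k = 1" and g2: "\<And>k l. \<gamma> k l * \<gamma> l k = 1"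
    and g3: "\<And>i j k. i \<noteq> j \<Longrightarrow> j \<noteq> k \<Longrightarrow> i \<noteq> k \<Longrightarrow> \<gamma> i k = \<gamma> i j * \<gamma> j k"
  shows "\<exists>d. invertible d \<and> (\<forall>x. S x = d ** x ** matrix_inv d)"
proof -
  fix p :: 'n
  define c where "c k = \<gamma> k p" for k
  have cn: "c k \<noteq> 0" for k using g2[of k p] by (auto simp: c_def)
  have gc: "\<gamma> k l = c k / c l" for k l
  proof -
    have "1 / c l = \<gamma> p l" using g2[of l p] cn[of l] by (simp add: c_def field_simps)
    moreover have "\<gamma> k l = c k * \<gamma> p l"
      by (cases "k = l"; cases "k = p"; cases "l = p") (auto simp: c_def g1 g2 intro: g3)
    ultimately show ?thesis by (simp add: divide_inverse)
  qed
  define d where "d = diagm c"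
  have dd: "d ** diagm (\<lambda>k. 1 / c k) = mat 1"
    using cn by (auto simp: d_def diagm_mult vec_eq_iff mat_nth)
  then have inv: "invertible d" using invertible_right_inverse by blast
  have "S x = d ** x ** matrix_inv d" for x
  proof -
    have dn: "(d ** y) $ a $ b = c a * y $ a $ b" for y :: "complex^'n^'n" and a b
    proof -
      have "(d ** y) $ a $ b = (\<Sum>k\<in>UNIV. if k = a then c a * y $ a $ b else 0)"
        unfolding mult_nth d_def by (intro sum.cong) auto
      then show ?thesis by simp
    qed
    have "S x $ a $ b = (d ** x ** matrix_inv d) $ a $ b" for a b
    proof -
      have "S x $ a $ b = (\<Sum>i\<in>UNIV. \<Sum>j\<in>UNIV. x $ i $ j * (\<gamma> i j * munit i j $ a $ b))"
        by (subst clin_expand[OF S]) (simp add: g)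
      also have "\<dots> = (\<Sum>i\<in>UNIV. \<Sum>j\<in>UNIV. if j = b then (if i = a then x $ a $ b * \<gamma> a b else 0) else 0)"
        by (intro sum.cong) auto
      also have "\<dots> = x $ a $ b * \<gamma> a b" by simp
      also have "\<dots> = (d ** x ** matrix_inv d) $ a $ b"
        by (simp add: inv_unique[OF dd] mult_diagm_nth dn gc)
      finally show ?thesis .
    qed
    then show ?thesis by (simp add: vec_eq_iff)
  qed
  with inv show ?thesis by blast
qed

lemma transpose_munit: "transpose (munit i j) = munit j i"
  by (auto simp: vec_eq_iff transpose_def)

text \<open>A Peirce decomposition: the fixed diagonal idempotents confine the image of
  \<open>munit i j\<close> to the span of \<open>munit i j\<close> and \<open>munit j i\<close>. One
  nonzero \<open>\<alpha>\<close> off the diagonal then switches off every \<open>\<beta>\<close>,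
  so the choice between automorphism and antiautomorphism is the same for all units.\<close>

lemma jordan_diagonal_fixing:
  fixes S :: "complex^'n^'n \<Rightarrow> complex^'n^'n"
  assumes S: "clin S" and sq: "\<And>h. S (h ** h) = S h ** S h"
    and tr: "\<And>h. trace (S h ** S h) = trace (h ** h)"
    and diag: "\<And>i. S (munit i i) = munit i i"
  shows "\<exists>u. invertible u \<and> ((\<forall>x. S x = u ** x ** matrix_inv u) \<or> (\<forall>x. S x = u ** transpose x ** matrix_inv u))"
proof -
  note J = jordan_if_square[of S, OF S sq]
  define \<alpha> where "\<alpha> i j = S (munit i j) $ i $ j" for i j
  define \<beta> where "\<beta> i j = S (munit i j) $ j $ i" for i j
  \<comment> \<open>For \<open>i \<noteq> j\<close> the unit is the sum of its left and right
    products with \<open>munit i i\<close>, and so is its image; hence an entry survives only if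
    exactly one of its indices is \<open>i\<close>. The same holds for \<open>j\<close>.\<close>
  have zero: "S (munit i j) $ a $ b = 0" if ij: "i \<noteq> j" and ab: "(a, b) \<noteq> (i, j)" "(a, b) \<noteq> (j, i)" for i j a b
  proof -
    let ?X = "S (munit i j)"
    have hi: "?X = munit i i ** ?X + ?X ** munit i i"
    proof -
      have e: "munit i i ** munit i j + munit i j ** munit i i = munit i j" using ij by (simp add: munit_mult)
      show ?thesis using J[of "munit i i" "munit i j"] unfolding e diag .
    qed
    have 1: "?X $ a $ b = (if a = i then ?X $ a $ b else 0) + (if b = i then ?X $ a $ b else 0)"
      using arg_cong[OF hi, of "\<lambda>M. M $ a $ b"] unfolding vector_add_component munit_diag_mult_nth .
    have hj: "?X = munit j j ** ?X + ?X ** munit j j"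
    proof -
      have e: "munit j j ** munit i j + munit i j ** munit j j = munit i j" using ij by (simp add: munit_mult)
      show ?thesis using J[of "munit j j" "munit i j"] unfolding e diag .
    qed
    have 2: "?X $ a $ b = (if a = j then ?X $ a $ b else 0) + (if b = j then ?X $ a $ b else 0)"
      using arg_cong[OF hj, of "\<lambda>M. M $ a $ b"] unfolding vector_add_component munit_diag_mult_nth .
    have "x = 0" if "x = (if a = i then x else 0) + (if b = i then x else 0)"
        "x = (if a = j then x else 0) + (if b = j then x else 0)" for x :: complex
      using that ij ab by (cases "a = i"; cases "b = i"; cases "a = j"; cases "b = j") simp_all
    from this[OF 1 2] show ?thesis .
  qed
  have form: "S (munit i j) = csm (\<alpha> i j) (munit i j) + csm (\<beta> i j) (munit j i)" if ij: "i \<noteq> j" for i j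
  proof -
    have "S (munit i j) $ a $ b = (csm (\<alpha> i j) (munit i j) + csm (\<beta> i j) (munit j i)) $ a $ b" for a b
      using zero[OF ij, of a b] ij by (auto simp: \<alpha>_def \<beta>_def)
    then show ?thesis by (simp add: vec_eq_iff)
  qed
  \<comment> \<open>The square of \<open>munit i j\<close> is 0, and the square of its image has the
    diagonal entry \<open>\<alpha> i j * \<beta> i j\<close>.\<close>
  have ab0: "\<alpha> i j * \<beta> i j = 0" if ij: "i \<noteq> j" for i j
  proof -
    have "S (munit i j) ** S (munit i j) = 0"
      using sq[of "munit i j"] ij by (simp add: munit_mult clin_0[OF S])
    then have "(S (munit i j) ** S (munit i j)) $ i $ i = 0" by simp
    then show ?thesis
      using ij by (auto simp: form mult_add csm_mult csm_simps munit_mult)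
  qed
  have ab1: "\<alpha> i j * \<alpha> j i + \<beta> i j * \<beta> j i = 1" if ij: "i \<noteq> j" for i j
  proof -
    have t: "trace (munit a b) = (if a = b then 1 else 0)" for a b :: 'n
      using trace_munit[of a b "mat 1 :: complex^'n^'n"] by (simp add: mat_nth)
    have "trace (S (munit i j) ** S (munit j i)) = 1"
      using clin_trace_polarized[OF S tr, of "munit i j" "munit j i"] by (simp add: munit_mult t)
    then show ?thesis
      using ij ij[symmetric] by (simp add: form mult_add csm_mult csm_simps munit_mult trace_add trace_csm t mult.commute)
  qed
  have ab2: "\<alpha> i k = \<alpha> i j * \<alpha> j k" "\<beta> i k = \<beta> i j * \<beta> j k" if ijk: "i \<noteq> j" "j \<noteq> k" "i \<noteq> k" for i j k
  proof -
    have "S (munit i k) = S (munit i j) ** S (munit j k) + S (munit j k) ** S (munit i j)"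
      using J[of "munit i j" "munit j k"] ijk by (simp add: munit_mult)
    then have e: "S (munit i k) = csm (\<alpha> i j * \<alpha> j k) (munit i k) + csm (\<beta> i j * \<beta> j k) (munit k i)"
      using ijk by (simp add: form mult_add csm_mult csm_simps munit_mult mult.commute)
    show "\<alpha> i k = \<alpha> i j * \<alpha> j k" "\<beta> i k = \<beta> i j * \<beta> j k"
      unfolding \<alpha>_def[of i k] \<beta>_def[of i k] e using ijk by auto
  qed
  show ?thesis
  proof (cases "\<exists>i j. i \<noteq> j \<and> \<alpha> i j \<noteq> 0")
    case True
    then obtain i j where ij: "i \<noteq> j" "\<alpha> i j \<noteq> 0" by blast
    have bij: "\<beta> i j = 0" using ab0[OF ij(1)] ij(2) by simp
    have row: "\<beta> i k = 0" if "k \<noteq> i" for k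
    proof (cases "k = j")
      case False
      then show ?thesis using ab2(2)[of i j k] ij that bij by auto
    qed (simp add: bij)
    \<comment> \<open>In column \<open>i\<close>, \<open>ab1\<close> together with
      \<open>\<beta> i k = 0\<close> makes \<open>\<alpha> k i\<close> nonzero, so
      \<open>ab0\<close> kills \<open>\<beta> k i\<close>; any other pair factors through
      \<open>i\<close> by \<open>ab2\<close>.\<close>
    have row': "\<beta> k l = 0" if "k \<noteq> l" for k l
    proof (cases "k = i \<or> l = i")
      case True
      then show ?thesis
      proof
        assume "l = i"
        then have "\<alpha> i k * \<alpha> k i = 1" using ab1[of i k] row[of k] that by simp
        then show ?thesis using ab0[of k l] that \<open>l = i\<close> by auto
      qed (use row that in simp)
    next
      case False
      then show ?thesis using ab2(2)[of k i l] row[of l] that by auto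
    qed
    have "\<exists>d. invertible d \<and> (\<forall>x. S x = d ** x ** matrix_inv d)"
    proof (rule inner_if_scales_units[OF S, of "\<lambda>k l. if k = l then 1 else \<alpha> k l"])
      show "S (munit k l) = csm (if k = l then 1 else \<alpha> k l) (munit k l)" for k l
        by (cases "k = l") (simp_all add: diag form row' csm_simps)
      show "(if k = l then 1 else \<alpha> k l) * (if l = k then 1 else \<alpha> l k) = 1" for k l
        using ab1[of k l] row'[of k l] by (cases "k = l") auto
      show "(if i = k then 1 else \<alpha> i k) = (if i = j then 1 else \<alpha> i j) * (if j = k then 1 else \<alpha> j k)"
        if "i \<noteq> j" "j \<noteq> k" "i \<noteq> k" for i j k
        using ab2(1)[OF that] that by simp
    qed simp
    then show ?thesis by blast
  next
    case False
    then have a0: "\<alpha> k l = 0" if "k \<noteq> l" for k l using that by blast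
    \<comment> \<open>Transposing the image exchanges \<open>\<alpha>\<close> and
      \<open>\<beta>\<close>. Dimension 1 also falls under this case, there being no off-diagonal
      units.\<close>
    have St: "clin (\<lambda>x. transpose (S x))"
      using S unfolding clin_def by (simp add: transpose_def vec_eq_iff)
    have "\<exists>d. invertible d \<and> (\<forall>x. transpose (S x) = d ** x ** matrix_inv d)"
    proof (rule inner_if_scales_units[OF St, of "\<lambda>k l. if k = l then 1 else \<beta> k l"])
      have tc: "transpose (csm c X) = csm c (transpose X)" for c and X :: "complex^'n^'n"
        by (simp add: transpose_def vec_eq_iff)
      show "transpose (S (munit k l)) = csm (if k = l then 1 else \<beta> k l) (munit k l)" for k l
        by (cases "k = l") (simp_all add: diag form a0 csm_simps transpose_munit tc)
      show "(if k = l then 1 else \<beta> k l) * (if l = k then 1 else \<beta> l k) = 1" for k l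
        using ab1[of k l] a0[of k l] by (cases "k = l") auto
      show "(if i = k then 1 else \<beta> i k) = (if i = j then 1 else \<beta> i j) * (if j = k then 1 else \<beta> j k)"
        if "i \<noteq> j" "j \<noteq> k" "i \<noteq> k" for i j k
        using ab2(2)[OF that] that by simp
    qed simp
    then obtain d where d: "invertible d" "\<And>x. transpose (S x) = d ** x ** matrix_inv d" by blast
    define u where "u = transpose (matrix_inv d)"
    have ud: "u ** transpose d = mat 1"
      using inv_inverse[OF d(1)] by (simp add: u_def matrix_transpose_mul[symmetric])
    then have "invertible u" using invertible_right_inverse by blast
    moreover have "S x = u ** transpose x ** matrix_inv u" for x
    proof -
      have "S x = transpose (d ** x ** matrix_inv d)" by (simp add: d(2)[symmetric])
      then show ?thesis unfolding inv_unique[OF ud] by (simp add: matrix_transpose_mul u_def matrix_mul_assoc)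
    qed
    ultimately show ?thesis by blast
  qed
qed

text \<open>The images of the diagonal units are nonzero orthogonal idempotents, as many as the
  dimension, so one vector from each range gives a basis. In that basis the diagonal units are
  fixed.\<close>

lemma jordan_form:
  fixes T :: "complex^'n^'n \<Rightarrow> complex^'n^'n"
  assumes T: "clin T" and t2: "\<And>h. trace (T h ** T h) = trace (h ** h)"
    and t3: "\<And>h. trace (T h ** T h ** T h) = trace (h ** h ** h)"
  shows "\<exists>u. invertible u \<and> ((\<forall>x. T x = u ** x ** matrix_inv u) \<or> (\<forall>x. T x = u ** transpose x ** matrix_inv u))"
proof -
  note sq = square_if_trace_cube[of T, OF T t2 t3]
  note J = jordan_if_square[of T, OF T sq]
  define e where "e i = T (munit i i)" for i
  have ee: "e i ** e i = e i" for i
    using sq[of "munit i i"] by (simp add: e_def munit_mult)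
  have ort: "e i ** e j = 0" if "i \<noteq> j" for i j
  proof -
    have s: "e i ** e j + e j ** e i = 0"
      using J[of "munit i i" "munit j j"] that by (simp add: e_def munit_mult clin_0[OF T])
    \<comment> \<open>Multiplying the anticommutation relation by \<open>e i\<close> on either side
      gives the same value for both products; they commute and anticommute, hence vanish.\<close>
    have "e i ** (e i ** e j + e j ** e i) = 0" "(e i ** e j + e j ** e i) ** e i = 0" by (simp_all add: s)
    then have "e i ** e j + e i ** e j ** e i = 0" "e i ** e j ** e i + e j ** e i = 0"
      by (simp_all add: mult_add matrix_mul_assoc ee) (simp_all add: matrix_mul_assoc[symmetric] ee)
    then have "e i ** e j = - (e i ** e j ** e i)" "e j ** e i = - (e i ** e j ** e i)"
      by (simp_all add: eq_neg_iff_add_eq_0 add.commute)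
    then have "e i ** e j = e j ** e i" by (rule trans[OF _ sym])
    with s have "2 *\<^sub>R (e i ** e j) = 0" by (simp add: scaleR_2)
    then show ?thesis by simp
  qed
  have "\<exists>v. v \<noteq> 0 \<and> e i *v v = v" for i
  proof -
    have "trace (e i ** e i) = 1"
      using t2[of "munit i i"] trace_munit[of i i "munit i i"] by (simp add: e_def)
    then have "e i \<noteq> 0" by (auto simp: trace_def)
    then obtain x where "e i *v x \<noteq> 0" using matrix_eq[of "e i" 0] by auto
    then show ?thesis by (intro exI[of _ "e i *v x"]) (simp add: matrix_vector_mul_assoc ee)
  qed
  then obtain v where v: "\<And>i. v i \<noteq> 0" "\<And>i. e i *v v i = v i"
    using choice[of "\<lambda>i v. v \<noteq> 0 \<and> e i *v v = v"] by blast
  have ev: "e i *v v j = (if i = j then v j else 0)" for i j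
  proof (cases "i = j")
    case False
    have "e i *v v j = (e i ** e j) *v v j" by (simp add: matrix_vector_mul_assoc[symmetric] v)
    then show ?thesis using False by (simp add: ort)
  qed (simp add: v)
  define w where "w = (\<chi> a i. v i $ a)"
  have col: "column k w = v k" for k by (simp add: w_def column_def vec_eq_iff)
  have "x = 0" if x: "w *v x = 0" for x
  proof -
    have "x $ j = 0" for j
    proof -
      have "(\<Sum>i\<in>UNIV. (x $ i) *s v i) = 0" using x by (simp add: matrix_mult_sum col)
      then have "e j *v (\<Sum>i\<in>UNIV. (x $ i) *s v i) = 0" by simp
      then have "(\<Sum>i\<in>UNIV. (x $ i) *s (if j = i then v i else 0)) = 0"
        by (simp add: matrix_vector_sum vector_scalar_commute ev)
      moreover have "(\<Sum>i\<in>UNIV. (x $ i) *s (if j = i then v i else 0)) = (\<Sum>i\<in>UNIV. if j = i then (x $ j) *s v j else 0)"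
        by (intro sum.cong) auto
      ultimately have "(x $ j) *s v j = 0" by simp
      then show ?thesis using v(1) by simp
    qed
    then show ?thesis by (simp add: vec_eq_iff)
  qed
  then have inv: "invertible w" unfolding invertible_left_inverse matrix_left_invertible_ker by blast
  have ew: "e i ** w = w ** munit i i" for i
  proof -
    have "(e i ** w) $ a $ j = (w ** munit i i) $ a $ j" for a j
    proof -
      have "(e i ** w) $ a $ j = (e i *v v j) $ a" by (simp add: mult_nth w_def matrix_vector_mult_def)
      then show ?thesis by (simp add: ev munit_diag_mult_nth) (simp add: w_def)
    qed
    then show ?thesis by (simp add: vec_eq_iff)
  qed
  define S where "S x = matrix_inv w ** T x ** w" for x
  have cS: "clin S" using T unfolding clin_def S_def by (simp add: mult_add csm_mult)
  have SS: "S h ** S h = matrix_inv w ** (T h ** T h) ** w" for h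
  proof -
    have "S h ** S h = matrix_inv w ** T h ** (w ** matrix_inv w) ** T h ** w"
      by (simp add: S_def matrix_mul_assoc)
    then show ?thesis by (simp add: inv_inverse[OF inv] matrix_mul_assoc)
  qed
  have "\<exists>u. invertible u \<and> ((\<forall>x. S x = u ** x ** matrix_inv u) \<or> (\<forall>x. S x = u ** transpose x ** matrix_inv u))"
  proof (rule jordan_diagonal_fixing[OF cS])
    show "S (h ** h) = S h ** S h" for h unfolding SS by (simp add: S_def sq)
    have "trace (matrix_inv w ** X ** w) = trace X" for X
      using trace_mul_sym[of "matrix_inv w ** X" w] by (simp add: matrix_mul_assoc inv_inverse[OF inv])
    then show "trace (S h ** S h) = trace (h ** h)" for h by (simp add: SS t2)
    show "S (munit i i) = munit i i" for i
      using ew[of i] inv_inverse[OF inv]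
      by (simp add: S_def e_def[symmetric] matrix_mul_assoc[symmetric]) (simp add: matrix_mul_assoc)
  qed
  then obtain u where u: "invertible u" "(\<forall>x. S x = u ** x ** matrix_inv u) \<or> (\<forall>x. S x = u ** transpose x ** matrix_inv u)"
    by blast
  have Tw: "T x = w ** S x ** matrix_inv w" for x
  proof -
    have "w ** S x ** matrix_inv w = (w ** matrix_inv w) ** T x ** (w ** matrix_inv w)"
      by (simp add: S_def matrix_mul_assoc)
    then show ?thesis by (simp add: inv_inverse[OF inv])
  qed
  have "(w ** u) ** (matrix_inv u ** matrix_inv w) = w ** (u ** matrix_inv u) ** matrix_inv w"
    by (simp add: matrix_mul_assoc)
  then have "(w ** u) ** (matrix_inv u ** matrix_inv w) = mat 1"
    by (simp add: inv_inverse[OF inv] inv_inverse[OF u(1)])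
  then have wu: "matrix_inv (w ** u) = matrix_inv u ** matrix_inv w" by (rule inv_unique)
  have "invertible (w ** u)" using inv u(1) by (rule invertible_mult)
  moreover have "w ** (u ** x ** matrix_inv u) ** matrix_inv w = (w ** u) ** x ** matrix_inv (w ** u)" for x
    by (simp add: wu matrix_mul_assoc)
  ultimately show ?thesis using u(2) unfolding Tw by (intro exI[of _ "w ** u"]) auto
qed

section \<open>Lipschitz maps\<close>

lemma norm_vec_mult_le: "norm ((A :: complex^'n^'n) *v v) \<le> real (CARD('n) * CARD('n)) * norm A * norm v"
proof -
  have "norm (A *v v) \<le> (\<Sum>i\<in>UNIV. norm ((A *v v) $ i))"
    unfolding norm_vec_def by (rule L2_set_le_sum) simp
  also have "\<dots> \<le> (\<Sum>i\<in>(UNIV :: 'n set). \<Sum>j\<in>(UNIV :: 'n set). norm A * norm v)"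
  proof (rule sum_mono)
    fix i :: 'n
    have "norm ((A *v v) $ i) \<le> (\<Sum>j\<in>UNIV. norm (A $ i $ j * v $ j))"
      by (simp add: matrix_vector_mult_def norm_sum)
    also have "\<dots> \<le> (\<Sum>j\<in>(UNIV :: 'n set). norm A * norm v)"
    proof (rule sum_mono)
      fix j :: 'n
      have "norm (A $ i $ j) \<le> norm A" by (rule order_trans[OF Finite_Cartesian_Product.norm_nth_le Finite_Cartesian_Product.norm_nth_le])
      then show "norm (A $ i $ j * v $ j) \<le> norm A * norm v"
        unfolding norm_mult by (intro mult_mono Finite_Cartesian_Product.norm_nth_le) auto
    qed
    finally show "norm ((A *v v) $ i) \<le> (\<Sum>j\<in>(UNIV :: 'n set). norm A * norm v)" .
  qed
  finally show ?thesis by (simp add: mult.assoc)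
qed

lemma bounded_linear_matrix_vector: "bounded_linear (\<lambda>v. (A :: complex^'n^'n) *v v)"
proof (rule bounded_linear_intro)
  show "A *v (r *\<^sub>R v) = r *\<^sub>R (A *v v)" for r v
    by (simp add: vec_eq_iff matrix_vector_mult_def scaleR_sum_right)
  show "norm (A *v v) \<le> norm v * (real (CARD('n) * CARD('n)) * norm A)" for v
    using norm_vec_mult_le[of A v] by (simp add: mult_ac)
qed (rule matrix_vector_right_distrib)

lemma mat_opnorm_le: "mat_opnorm (A :: complex^'n^'n) \<le> real (CARD('n) * CARD('n)) * norm A"
  unfolding mat_opnorm_def
  by (rule onorm_bound[OF _ norm_vec_mult_le]) simp

text \<open>\<open>norm\<close> is Euclidean in the entries. Each entry is a coordinate of the image
  of a unit vector, hence at most the operator norm, and the factor counts the entries.\<close>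

lemma norm_le_mat_opnorm: "norm (A :: complex^'n^'n) \<le> real (CARD('n) * CARD('n)) * mat_opnorm A"
proof -
  have "norm A \<le> (\<Sum>i\<in>UNIV. norm (A $ i))"
    unfolding norm_vec_def[of A] by (rule L2_set_le_sum) simp
  also have "\<dots> \<le> (\<Sum>i\<in>(UNIV :: 'n set). \<Sum>j\<in>(UNIV :: 'n set). mat_opnorm A)"
  proof (rule sum_mono)
    fix i :: 'n
    have "norm (A $ i) \<le> (\<Sum>j\<in>UNIV. norm (A $ i $ j))"
      unfolding norm_vec_def by (rule L2_set_le_sum) simp
    also have "\<dots> \<le> (\<Sum>j\<in>(UNIV :: 'n set). mat_opnorm A)"
    proof (rule sum_mono)
      fix j :: 'n
      have "norm (A $ i $ j) \<le> norm (A *v axis j 1)"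
        unfolding mult_axis_nth[symmetric] by (rule Finite_Cartesian_Product.norm_nth_le)
      also have "\<dots> \<le> mat_opnorm A * norm (axis j 1 :: complex^'n)"
        unfolding mat_opnorm_def by (rule onorm[OF bounded_linear_matrix_vector])
      finally show "norm (A $ i $ j) \<le> mat_opnorm A" by simp
    qed
    finally show "norm (A $ i) \<le> (\<Sum>j\<in>(UNIV :: 'n set). mat_opnorm A)" .
  qed
  finally show ?thesis by (simp add: mult.assoc)
qed

lemma lipschitz_if_opnorm_lipschitz:
  fixes F :: "complex^'n^'n \<Rightarrow> complex^'n^'n"
  assumes "opnorm_lipschitz F"
  obtains K where "\<And>x y. norm (F x - F y) \<le> K * norm (x - y)" "0 \<le> K"
proof -
  obtain L where L: "\<And>x y. mat_opnorm (F x - F y) \<le> L * mat_opnorm (x - y)"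
    using assms unfolding opnorm_lipschitz_def by blast
  define N where "N = real (CARD('n) * CARD('n))"
  have N: "0 \<le> N" by (simp add: N_def)
  have op0: "0 \<le> mat_opnorm A" for A :: "complex^'n^'n"
    unfolding mat_opnorm_def by (rule onorm_pos_le[OF bounded_linear_matrix_vector])
  have "norm (F x - F y) \<le> (N * (\<bar>L\<bar> * N)) * norm (x - y)" for x y
  proof -
    have "norm (F x - F y) \<le> N * mat_opnorm (F x - F y)" unfolding N_def by (rule norm_le_mat_opnorm)
    also have "\<dots> \<le> N * (\<bar>L\<bar> * mat_opnorm (x - y))"
      by (intro mult_left_mono N order_trans[OF L mult_right_mono[OF abs_ge_self op0]])
    also have "\<dots> \<le> N * (\<bar>L\<bar> * (N * norm (x - y)))"
      using N mat_opnorm_le[of "x - y"] by (intro mult_left_mono) (auto simp: N_def)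
    finally show ?thesis by (simp add: mult.assoc)
  qed
  then show ?thesis by (rule that) (simp add: N)
qed

text \<open>An infinite spectrum would make the characteristic polynomial vanish everywhere, so that
  every number is an eigenvalue, whereas eigenvalues are bounded by a multiple of
  \<open>norm h\<close>.\<close>

lemma finite_mat_spectrum: "finite (mat_spectrum (h :: complex^'n^'n))"
proof (rule ccontr)
  assume inf: "infinite (mat_spectrum h)"
  have pf: "polyfun (\<lambda>c. det (h - mat c))"
    by (intro polyfun_det matpoly_diff matpoly_const matpoly_mat polyfun_id)
  have "infinite {c. det (h - mat c) = 0}" using inf by (simp add: mat_spectrum_iff_det[symmetric])
  from polyfun_eq_0_if_infinite_zeros[OF pf this] have all: "c \<in> mat_spectrum h" for c
    by (simp add: mat_spectrum_iff_det)
  define M where "M = real (CARD('n) * CARD('n)) * norm h"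
  have "0 \<le> M" by (simp add: M_def)
  obtain v where v: "v \<noteq> 0" "h *v v = of_real (M + 1) *s v"
    using all[of "of_real (M + 1)"] by (auto simp: mat_spectrum_def)
  have "of_real (M + 1) *s v = (M + 1) *\<^sub>R v"
    by (simp add: vec_eq_iff) (simp add: scaleR_conv_of_real algebra_simps)
  then have "norm (h *v v) = (M + 1) * norm v" using \<open>0 \<le> M\<close> by (simp add: v(2))
  then have "(M + 1) * norm v \<le> M * norm v" using norm_vec_mult_le[of h v] by (simp add: M_def)
  then show False using v(1) by simp
qed

lemma mat_spectrum_scaleR:
  assumes "c \<in> mat_spectrum (A :: complex^'n^'n)"
  shows "of_real r * c \<in> mat_spectrum (r *\<^sub>R A)"
proof -
  obtain v where "v \<noteq> 0" "A *v v = c *s v" using assms by (auto simp: mat_spectrum_def)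
  moreover have "(r *\<^sub>R A) *v v = r *\<^sub>R (A *v v)"
    by (simp add: vec_eq_iff matrix_vector_mult_def scaleR_sum_right)
  moreover have "r *\<^sub>R (c *s v) = (of_real r * c) *s v"
    by (simp add: vec_eq_iff) (simp add: scaleR_conv_of_real)
  ultimately show ?thesis by (auto simp: mat_spectrum_def)
qed

lemma bounded_linear_csm: "bounded_linear (\<lambda>z. csm z (h :: complex^'n^'m))"
  unfolding linear_conv_bounded_linear[symmetric]
  by (rule linearI) (simp_all add: csm_simps csm_real[symmetric] scaleR_conv_of_real)

lemma tendsto_det:
  fixes M :: "'a \<Rightarrow> complex^'n^'n"
  assumes "(M \<longlongrightarrow> A) G"
  shows "((\<lambda>x. det (M x)) \<longlongrightarrow> det A) G"
  unfolding det_def by (intro tendsto_intros assms)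

section \<open>Lipschitz maps whose differences share an eigenvalue\<close>

context
  fixes F :: "complex^'n^'n \<Rightarrow> complex^'n^'n" and K :: real
  assumes lip: "\<And>x y. norm (F x - F y) \<le> K * norm (x - y)" and K: "0 \<le> K"
    and spec: "\<And>x y. mat_spectrum (F x - F y) \<inter> mat_spectrum (x - y) \<noteq> {}"
begin

text \<open>The shared eigenvalue may jump as the step tends to 0, but after rescaling it stays in
  the finite set \<open>mat_spectrum h\<close>. The product of determinants over this set vanishes
  for every step and is continuous in the quotient, so it vanishes in the limit.\<close>

lemma derivative_spectrum:
  assumes D: "(F has_derivative D) (at x)"
  shows "mat_spectrum (D h) \<inter> mat_spectrum h \<noteq> {}"
proof -
  interpret D: bounded_linear D using D by (rule has_derivative_bounded_linear)
  have eq: "(\<Prod>c\<in>mat_spectrum h. det ((F (x + s *\<^sub>R h) - F x) /\<^sub>R s - mat c)) = 0" if s: "s \<noteq> 0" for s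
  proof -
    obtain c where c: "c \<in> mat_spectrum (F (x + s *\<^sub>R h) - F x)" "c \<in> mat_spectrum (s *\<^sub>R h)"
      using spec[of "x + s *\<^sub>R h" x] by auto
    have "of_real (inverse s) * c \<in> mat_spectrum h"
      using mat_spectrum_scaleR[OF c(2), of "inverse s"] s by simp
    moreover have "of_real (inverse s) * c \<in> mat_spectrum ((F (x + s *\<^sub>R h) - F x) /\<^sub>R s)"
      by (rule mat_spectrum_scaleR[OF c(1)])
    ultimately show ?thesis
      using finite_mat_spectrum[of h] by (intro prod_zero) (auto simp: mat_spectrum_iff_det)
  qed
  have lim: "((\<lambda>s. (F (x + s *\<^sub>R h) - F x) /\<^sub>R s) \<longlongrightarrow> D h) (at 0)"
  proof -
    have "((\<lambda>s. F (x + s *\<^sub>R h)) has_derivative (\<lambda>s. D (s *\<^sub>R h))) (at 0)"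
    proof (rule has_derivative_compose[of "\<lambda>s. x + s *\<^sub>R h" "\<lambda>s. s *\<^sub>R h" 0 UNIV F D])
      show "((\<lambda>s. x + s *\<^sub>R h) has_derivative (\<lambda>s. s *\<^sub>R h)) (at 0)"
        by (auto intro!: derivative_eq_intros)
      show "(F has_derivative D) (at (x + 0 *\<^sub>R h))" using D by simp
    qed
    then have "((\<lambda>s. F (x + s *\<^sub>R h)) has_vector_derivative D h) (at 0)"
      by (simp add: has_vector_derivative_def D.scaleR)
    then have "((\<lambda>s. (1 / \<bar>s\<bar>) *\<^sub>R (F (x + s *\<^sub>R h) - (F x + s *\<^sub>R D h))) \<longlongrightarrow> 0) (at 0)"
      by (simp add: has_vector_derivative_def has_derivative_at2)
    from tendsto_norm_zero[OF this]
    have "((\<lambda>s. norm ((F (x + s *\<^sub>R h) - F x) /\<^sub>R s - D h)) \<longlongrightarrow> 0) (at 0)"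
    proof (rule Lim_transform_eventually)
      have "norm ((1 / \<bar>s\<bar>) *\<^sub>R (F (x + s *\<^sub>R h) - (F x + s *\<^sub>R D h))) = norm ((F (x + s *\<^sub>R h) - F x) /\<^sub>R s - D h)"
        if s: "s \<noteq> 0" for s
      proof -
        have "(F (x + s *\<^sub>R h) - F x) /\<^sub>R s - D h = (F (x + s *\<^sub>R h) - (F x + s *\<^sub>R D h)) /\<^sub>R s"
          using s by (simp add: scaleR_diff_right scaleR_add_right)
        then show ?thesis by (simp add: inverse_eq_divide)
      qed
      then show "\<forall>\<^sub>F s in at 0. norm ((1 / \<bar>s\<bar>) *\<^sub>R (F (x + s *\<^sub>R h) - (F x + s *\<^sub>R D h))) = norm ((F (x + s *\<^sub>R h) - F x) /\<^sub>R s - D h)"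
        by (simp add: eventually_at_filter)
    qed
    from tendsto_norm_zero_cancel[OF this] show ?thesis by (simp add: Lim_null[symmetric])
  qed
  have "((\<lambda>s::real. \<Prod>c\<in>mat_spectrum h. det ((F (x + s *\<^sub>R h) - F x) /\<^sub>R s - mat c)) \<longlongrightarrow>
      (\<Prod>c\<in>mat_spectrum h. det (D h - mat c))) (at 0)"
    by (intro tendsto_prod tendsto_det tendsto_diff lim tendsto_const)
  moreover have "((\<lambda>s::real. \<Prod>c\<in>mat_spectrum h. det ((F (x + s *\<^sub>R h) - F x) /\<^sub>R s - mat c)) \<longlongrightarrow> 0) (at 0)"
    by (rule tendsto_eventually) (auto simp: eventually_at_filter eq)
  ultimately have "(\<Prod>c\<in>mat_spectrum h. det (D h - mat c)) = 0"
    using tendsto_unique[OF trivial_limit_at] by blast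
  then show ?thesis using finite_mat_spectrum[of h] by (auto simp: prod_zero_iff mat_spectrum_iff_det)
qed

lemma derivative_clin:
  assumes D: "(F has_derivative D) (at x)"
  shows "clin D"
proof -
  interpret D: bounded_linear D using D by (rule has_derivative_bounded_linear)
  show ?thesis by (rule spectral_real_linear(1)[of D, OF D.add D.scaleR derivative_spectrum[OF D]])
qed

text \<open>Applied entry by entry with \<open>csm \<i> h\<close> as the second direction; complex
  linearity of the Frechet derivative makes it a complex derivative along the line.\<close>

lemma affine_on_complex_lines: "F (a + csm z h) = F a + csm z (F (a + h) - F a)"
proof -
  have "F (a + csm z h) $ i $ j = F a $ i $ j + z * (F (a + h) $ i $ j - F a $ i $ j)" for i j
    unfolding csm_Re_Im[of z h]
  proof (rule affine_on_complex_line_if_AE_field_differentiable[of "\<lambda>x. F x $ i $ j" K h "csm \<i> h"])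
    show "norm (F x $ i $ j - F y $ i $ j) \<le> K * norm (x - y)" for x y
    proof -
      have "norm ((F x - F y) $ i $ j) \<le> norm ((F x - F y) $ i)" by (rule Finite_Cartesian_Product.norm_nth_le)
      also have "\<dots> \<le> norm (F x - F y)" by (rule Finite_Cartesian_Product.norm_nth_le)
      finally show ?thesis using lip[of x y] by simp
    qed
    have "AE x in lborel. F differentiable at x" by (rule rademacher[of F K, OF lip])
    then show "AE x in lborel. \<exists>c. ((\<lambda>z. F (x + (Re z *\<^sub>R h + Im z *\<^sub>R csm \<i> h)) $ i $ j) has_field_derivative c) (at 0)"
    proof (rule eventually_mono)
      fix x assume "F differentiable at x"
      then obtain D where D: "(F has_derivative D) (at x)" by (auto simp: differentiable_def)
      have "((\<lambda>z. F (x + csm z h)) has_derivative (\<lambda>z. D (csm z h))) (at 0)"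
      proof (rule has_derivative_compose[of "\<lambda>z. x + csm z h" "\<lambda>z. csm z h" 0 UNIV F D])
        show "((\<lambda>z. x + csm z h) has_derivative (\<lambda>z. csm z h)) (at 0)"
          using bounded_linear_imp_has_derivative[OF bounded_linear_csm, of h "at 0"]
            has_derivative_add_const[of "\<lambda>z. csm z h" _ "at 0" x] by (simp add: add.commute)
        show "(F has_derivative D) (at (x + csm 0 h))" using D by (simp add: csm_simps)
      qed
      then have "((\<lambda>z. F (x + csm z h) $ i $ j) has_derivative (\<lambda>z. D (csm z h) $ i $ j)) (at 0)"
        by (intro bounded_linear.has_derivative[OF bounded_linear_vec_nth])
      then have "((\<lambda>z. F (x + csm z h) $ i $ j) has_field_derivative D h $ i $ j) (at 0)"
        unfolding has_field_derivative_def clinD(2)[OF derivative_clin[OF D]] csm_nth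
        by (simp only: mult.commute[of _ "D h $ i $ j"])
      then show "\<exists>c. ((\<lambda>z. F (x + (Re z *\<^sub>R h + Im z *\<^sub>R csm \<i> h)) $ i $ j) has_field_derivative c) (at 0)"
        unfolding csm_Re_Im[of _ h, symmetric] by blast
    qed
  qed
  then show ?thesis by (simp add: vec_eq_iff)
qed

text \<open>If \<open>X\<close> is the defect of additivity, affinity along lines gives F (a + t h)
  - F (t h) = F a + t X. The Lipschitz bound keeps the left side bounded for all real
  \<open>t\<close>, which forces \<open>X = 0\<close>.\<close>

lemma clin_if_zero:
  assumes 0: "F 0 = 0"
  shows "clin F"
proof -
  have sc: "F (csm z h) = csm z (F h)" for z h
    using affine_on_complex_lines[of 0 z h] by (simp add: 0)
  have "F (a + h) = F a + F h" for a h
  proof (rule ccontr)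
    define X where "X = F (a + h) - F a - F h"
    assume "F (a + h) \<noteq> F a + F h"
    then have X: "X \<noteq> 0" by (auto simp: X_def algebra_simps)
    have bd: "\<bar>t\<bar> * norm X \<le> 2 * K * norm a" for t
    proof -
      have "csm (of_real t) X = (F (a + csm (of_real t) h) - F (csm (of_real t) h)) - F a"
        by (simp add: affine_on_complex_lines sc X_def csm_simps)
      then have "t *\<^sub>R X = (F (a + csm (of_real t) h) - F (csm (of_real t) h)) - F a"
        by (simp only: csm_real)
      then have "\<bar>t\<bar> * norm X \<le> norm (F (a + csm (of_real t) h) - F (csm (of_real t) h)) + norm (F a)"
        using norm_triangle_ineq4[of "F (a + csm (of_real t) h) - F (csm (of_real t) h)" "F a"]
        by (simp only: norm_scaleR[symmetric])
      also have "\<dots> \<le> K * norm a + K * norm a"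
        using lip[of "a + csm (of_real t) h" "csm (of_real t) h"] lip[of a 0] by (simp add: 0)
      finally show ?thesis by simp
    qed
    \<comment> \<open>Chosen so that \<open>t * norm X\<close> exceeds the bound
      \<open>2 * K * norm a\<close> by exactly 1.\<close>
    define t where "t = (2 * K * norm a + 1) / norm X"
    have "t * norm X = 2 * K * norm a + 1" using X by (simp add: t_def)
    moreover have "t * norm X \<le> \<bar>t\<bar> * norm X" by (intro mult_right_mono) auto
    ultimately show False using bd[of t] by linarith
  qed
  then show ?thesis using sc by (simp add: clin_def)
qed

end

theorem theorem4:
  fixes F :: "complex^'n^'n \<Rightarrow> complex^'n^'n"
  assumes "opnorm_lipschitz F"
    and "F 0 = 0"
    and "\<And>x y. mat_spectrum (F x - F y) \<inter> mat_spectrum (x - y) \<noteq> {}"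
  shows "\<exists>u. invertible u \<and>
           ((\<forall>x. F x = u ** x ** matrix_inv u) \<or>
            (\<forall>x. F x = u ** transpose x ** matrix_inv u))"
proof -
  obtain K where K: "\<And>x y. norm (F x - F y) \<le> K * norm (x - y)" "0 \<le> K"
    using lipschitz_if_opnorm_lipschitz[OF assms(1)] by blast
  have lin: "clin F" by (rule clin_if_zero[of F K, OF K assms(3,2)])
  have scale: "F (r *\<^sub>R X) = r *\<^sub>R F X" for r X
    using clinD(2)[OF lin, of "of_real r" X] by (simp add: csm_real)
  \<comment> \<open>Taking \<open>y = 0\<close> makes \<open>F\<close> itself a real linear map
    sharing an eigenvalue with each argument, so the trace identities apply to it directly.\<close>
  have "mat_spectrum (F h) \<inter> mat_spectrum h \<noteq> {}" for h
    using assms(3)[of h 0] by (simp add: assms(2))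
  from spectral_real_linear(2,3)[of F, OF clinD(1)[OF lin] scale this]
  show ?thesis by (intro jordan_form lin)
qed

end
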